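(* In the setting of the context, there holds for all $v_h\in\mathcal V^0$ $$a_h^{DoD}(v_h,v_h)=\tfrac12\,|v_h|_\beta^2 .$$
   Context: **Geometry.** Let $L>0$, $0<x_0<L$, $0<\gamma<\pi/2$ with $(L-x_0)\tan\gamma<L$, and $\Omega=\{(x,y)\in(0,L)^2:\ y>(x-x_0)\tan\gamma\}$: a square from which a ramp of angle $\gamma$ is cut out; the ramp is the part of $\partial\Omega$ on the line $y=(x-x_0)\tan\gamma$. **Mesh.** The square is divided into a Cartesian background mesh of square cells $\widehat E$ of side length $h$; $\mathcal T_h$ is the set of all non-degenerate $E=\widehat E\cap\Omega$. The faces of a cell are its edges; $\mathcal F_i$ = interior faces (shared by two cells), $\mathcal F_b$ = faces on $\partial\Omega$, $\mathcal F=\mathcal F_i\cup\mathcal F_b$. $n_E$ is the outer unit normal of $E$; $|E|$ area, $|e|$ length. **Velocity.** $\beta:\overline\Omega\to\mathbb R^2$ is Lipschitz continuous, $\nabla\cdot\beta=0$, $\beta\cdot n=0$ along the ramp, $\beta$ does not vanish on the ramp, and the sign of $\beta\cdot n$ is constant along each face of the mesh. **Stabilized cut cells.** A triangular cut cell $E\in\mathcal T_h$ has a hypotenuse $e_{bdy}$ on the ramp, one inflow face $e_{in}=e_{in}(E)$ ($\beta\cdot n_E<0$) with neighbor $E_{in}$, and one outflow face $e_{out}=e_{out}(E)$ ($\beta\cdot n_E>0$) with neighbor $E_{out}$. $\mathcal I$ is the set of triangular cut cells with $\max(|e_{in}|,|e_{out}|)<\tfrac12h$; for $E\in\mathcal I$,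 $e_{in},e_{out}\notin\mathcal F_b$. $\mathcal F_{\setminus o}$ = faces that are not outflow faces $e_{out}$ of cells in $\mathcal I$; $\mathcal F_{\setminus io}$ = faces that are neither $e_{in}$ nor $e_{out}$ of cells in $\mathcal I$. With a fixed $\tau>0$, the capacity is $\alpha_E=\min\big(\frac{|E|}{\tau h\int_{e_{in}}|\beta\cdot n|},1\big)$. **Spaces, means, jumps.** $\mathcal V^0$ = functions in $L^2(\Omega)$ constant on each $E\in\mathcal T_h$; $\mathcal V^0_*=H^1(\Omega)+\mathcal V^0$. For $v\in\mathcal V^0_*$, a cell $E$ and a face $e\subset\partial E$, the $\beta$-weighted mean $\bar v_{E,e}\in\mathbb R$ is defined by $\bar v_{E,e}\int_e|\beta\cdot n|\,ds=\int_e|\beta\cdot n|\,\mathrm{tr}(v|_E)\,ds$ (irrelevant, say $0$, where $\beta\cdot n\equiv0$ on $e$; for $v\in\mathcal V^0$ it is the constant value $v|_E$). On an interior face $e$ between $E_1,E_2$: $[\![\bar v]\!]=\bar v_{E_1,e}n_{E_1}+\bar v_{E_2,e}n_{E_2}$, and $\bar v^\uparrow$ is the mean $\bar v_{E_i,e}$ from the upwind cell, i.e. the $E_i$ with $\beta\cdot n_{E_i}>0$. On a boundary face of $E$: $[\![\bar v]\!]=\bar v_{E,e}n_E$, and $\bar v^\uparrow=\bar v_{E,e}$ if $\beta\cdot n_E>0$, $\bar v^\uparrow=0$ otherwise. $[\![\bar v]\!]^2=[\![\bar v]\!]\cdot[\![\bar v]\!]$. For $E\in\mathcal I$: $\bar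 v_{in}=\bar v_{E_{in},e_{in}}$, $\bar v_{out}=\bar v_{E_{out},e_{out}}$. **Bilinear form.** For $v\in\mathcal V^0_*$, $w_h\in\mathcal V^0$, $$a_h^{DoD}(v,w_h)=\sum_{e\in\mathcal F_{\setminus o}}\int_e\bar v^\uparrow\,\beta\cdot[\![\bar w_h]\!]+\sum_{E\in\mathcal I}\int_{e_{out}(E)}\big(\alpha_E\bar v^\uparrow+(1-\alpha_E)\bar v_{in}\big)\beta\cdot[\![\bar w_h]\!].$$ **Seminorm.** For $v\in\mathcal V^0_*$, $$|v|_\beta^2=\sum_{e\in\mathcal F_{\setminus io}}\int_e|\beta\cdot n|[\![\bar v]\!]^2+\sum_{E\in\mathcal I}\Big(\alpha_E\sum_{e\in\{e_{in}(E),e_{out}(E)\}}\int_e|\beta\cdot n|[\![\bar v]\!]^2+(1-\alpha_E)\int_{e_{out}(E)}|\beta\cdot n|(\bar v_{out}-\bar v_{in})^2\Big).$$ *)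

theory Defs
  imports "HOL-Analysis.Analysis"
begin

type_synonym plane = "real \<times> real"

text \<open>
  Arc length integral over a line segment; the value does not depend on the chosen orientation
  of the end points.
\<close>

definition segment_integral :: "plane set \<Rightarrow> (plane \<Rightarrow> real) \<Rightarrow> real" where
  "segment_integral e f =
     (let (a, b) = (SOME (a, b). e = closed_segment a b)
      in dist a b * (LINT t|lebesgue_on {0..1}. f (linepath a b t)))"

definition segment_length :: "plane set \<Rightarrow> real" where
  "segment_length e = segment_integral e (\<lambda>_. 1)"

definition outer_normal :: "plane set \<Rightarrow> plane set \<Rightarrow> plane" where
  "outer_normal E e = (THE n. norm n = 1 \<and> (\<forall>x\<in>e. \<forall>y\<in>e. n \<bullet> (x - y) = 0) \<and>
                              (\<forall>x\<in>E. \<forall>y\<in>e. n \<bullet> (x - y) < 0))"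

text \<open>
  The trace of \<open>v|\<^sub>E\<close> at a boundary point, as the limit of averages. For a Lipschitz domain
  \<open>E\<close> and \<open>v|\<^sub>E\<close> in \<open>H\<^sup>1(E)\<close> this is the usual Sobolev trace at almost every boundary point;
  in particular it only depends on the almost-everywhere class of \<open>v\<close>.
\<close>

definition cell_trace :: "plane set \<Rightarrow> (plane \<Rightarrow> real) \<Rightarrow> plane \<Rightarrow> real" where
  "cell_trace E v x = Lim (at_right 0)
     (\<lambda>r. (LINT y|lebesgue_on (E \<inter> ball x r). v y) / measure lebesgue (E \<inter> ball x r))"

locale dod_data =
  fixes L x0 \<gamma> h :: real
    and \<beta> :: "plane \<Rightarrow> plane"
    and \<tau> :: real
begin

definition \<Omega> :: "plane set" where
  "\<Omega> = {(x, y). 0 < x \<and> x < L \<and> 0 < y \<and> y < L \<and> (x - x0) * tan \<gamma> < y}"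

definition ramp :: "plane set" where
  "ramp = {(x, y) \<in> frontier \<Omega>. y = (x - x0) * tan \<gamma>}"

definition ramp_normal :: plane where
  "ramp_normal = (sin \<gamma>, - cos \<gamma>)"

definition background_mesh :: "plane set set" where
  "background_mesh =
     {{real i * h <..< real (i + 1) * h} \<times> {real j * h <..< real (j + 1) * h} | i j.
        real (i + 1) * h \<le> L \<and> real (j + 1) * h \<le> L}"

definition cells :: "plane set set" where
  "cells = {E' \<inter> \<Omega> | E'. E' \<in> background_mesh \<and> measure lebesgue (E' \<inter> \<Omega>) > 0}"

text \<open>
  Cells are open convex polygons, so their faces are the edges of the closed polygon in the sense
  of convex geometry. The mesh is conforming: neighbouring cells share the same edge as a set.
\<close>

definition face_of_cell :: "plane set \<Rightarrow> plane set \<Rightarrow> bool" where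
  "face_of_cell e E \<longleftrightarrow> E \<in> cells \<and> e edge_of closure E"

definition interior_faces :: "plane set set" where
  "interior_faces = {e. \<exists>E1 E2. E1 \<noteq> E2 \<and> face_of_cell e E1 \<and> face_of_cell e E2}"

definition boundary_faces :: "plane set set" where
  "boundary_faces = {e. (\<exists>E. face_of_cell e E) \<and> e \<subseteq> frontier \<Omega>}"

definition faces :: "plane set set" where
  "faces = interior_faces \<union> boundary_faces"

text \<open>
  The sign of \<open>\<beta> \<bullet> n\<close> on a face is understood for the face as a whole: it is positive if
  \<open>\<beta> \<bullet> n\<close> is nonnegative and not identically zero. Isolated zeros, for instance at end points,
  are thereby permitted.
\<close>

definition outflow_face :: "plane set \<Rightarrow> plane set \<Rightarrow> bool" where
  "outflow_face E e \<longleftrightarrow> face_of_cell e E \<and>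
     (\<forall>x\<in>e. \<beta> x \<bullet> outer_normal E e \<ge> 0) \<and> (\<exists>x\<in>e. \<beta> x \<bullet> outer_normal E e > 0)"

definition inflow_face :: "plane set \<Rightarrow> plane set \<Rightarrow> bool" where
  "inflow_face E e \<longleftrightarrow> face_of_cell e E \<and>
     (\<forall>x\<in>e. \<beta> x \<bullet> outer_normal E e \<le> 0) \<and> (\<exists>x\<in>e. \<beta> x \<bullet> outer_normal E e < 0)"

definition e_in :: "plane set \<Rightarrow> plane set" where
  "e_in E = (THE e. inflow_face E e)"

definition e_out :: "plane set \<Rightarrow> plane set" where
  "e_out E = (THE e. outflow_face E e)"

definition neighbor :: "plane set \<Rightarrow> plane set \<Rightarrow> plane set" where
  "neighbor E e = (THE E'. E' \<noteq> E \<and> face_of_cell e E')"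

definition triangular_cut_cells :: "plane set set" where
  "triangular_cut_cells =
     {E \<in> cells. 2 simplex (closure E) \<and> (\<exists>e. face_of_cell e E \<and> e \<subseteq> ramp)}"

definition stabilized :: "plane set set" where
  "stabilized = {E \<in> triangular_cut_cells.
     max (segment_length (e_in E)) (segment_length (e_out E)) < h / 2}"

definition faces_no_out :: "plane set set" where
  "faces_no_out = faces - e_out ` stabilized"

definition faces_no_in_out :: "plane set set" where
  "faces_no_in_out = faces - (e_in ` stabilized \<union> e_out ` stabilized)"

text \<open>The modulus \<open>|\<beta> \<bullet> n|\<close> on a face; it does not depend on the side defining the normal.\<close>

definition abs_flux :: "plane set \<Rightarrow> plane \<Rightarrow> real" where
  "abs_flux e x = \<bar>\<beta> x \<bullet> outer_normal (SOME E. face_of_cell e E) e\<bar>"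

definition capacity :: "plane set \<Rightarrow> real" where
  "capacity E =
     min (measure lebesgue E / (\<tau> * h * segment_integral (e_in E) (abs_flux (e_in E)))) 1"

definition V0 :: "(plane \<Rightarrow> real) set" where
  "V0 = {v. v \<in> borel_measurable (lebesgue_on \<Omega>) \<and>
            integrable (lebesgue_on \<Omega>) (\<lambda>x. (v x)\<^sup>2) \<and>
            (\<forall>E\<in>cells. \<exists>c. AE x in lebesgue_on E. v x = c)}"

text \<open>If \<open>\<beta> \<bullet> n\<close> vanishes on \<open>e\<close>, the mean is \<open>0\<close>, by division by zero.\<close>

definition beta_mean :: "(plane \<Rightarrow> real) \<Rightarrow> plane set \<Rightarrow> plane set \<Rightarrow> real" where
  "beta_mean v E e =
     segment_integral e (\<lambda>x. abs_flux e x * cell_trace E v x) / segment_integral e (abs_flux e)"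

text \<open>The sum has two terms on an interior face and one term on a boundary face.\<close>

definition jump :: "(plane \<Rightarrow> real) \<Rightarrow> plane set \<Rightarrow> plane" where
  "jump v e = (\<Sum>E | face_of_cell e E. beta_mean v E e *\<^sub>R outer_normal E e)"

text \<open>
  An inflow face of the domain is an outflow face of no cell, so that the upwind value is \<open>0\<close>.
  The same value is used where \<open>\<beta> \<bullet> n\<close> vanishes on the whole face and there is no upwind cell.
\<close>

definition upwind :: "(plane \<Rightarrow> real) \<Rightarrow> plane set \<Rightarrow> real" where
  "upwind v e =
     (if \<exists>E. outflow_face E e then beta_mean v (THE E. outflow_face E e) e else 0)"

definition mean_in :: "(plane \<Rightarrow> real) \<Rightarrow> plane set \<Rightarrow> real" where
  "mean_in v E = beta_mean v (neighbor E (e_in E)) (e_in E)"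

definition mean_out :: "(plane \<Rightarrow> real) \<Rightarrow> plane set \<Rightarrow> real" where
  "mean_out v E = beta_mean v (neighbor E (e_out E)) (e_out E)"

definition a_DoD :: "(plane \<Rightarrow> real) \<Rightarrow> (plane \<Rightarrow> real) \<Rightarrow> real" where
  "a_DoD v w =
     (\<Sum>e\<in>faces_no_out. segment_integral e (\<lambda>x. upwind v e * (\<beta> x \<bullet> jump w e))) +
     (\<Sum>E\<in>stabilized. segment_integral (e_out E)
        (\<lambda>x. (capacity E * upwind v (e_out E) + (1 - capacity E) * mean_in v E) *
              (\<beta> x \<bullet> jump w (e_out E))))"

definition beta_seminorm :: "(plane \<Rightarrow> real) \<Rightarrow> real" where
  "beta_seminorm v = sqrt (
     (\<Sum>e\<in>faces_no_in_out. segment_integral e (\<lambda>x. abs_flux e x * (jump v e \<bullet> jump v e))) +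
     (\<Sum>E\<in>stabilized.
        capacity E * (\<Sum>e\<in>{e_in E, e_out E}.
           segment_integral e (\<lambda>x. abs_flux e x * (jump v e \<bullet> jump v e))) +
        (1 - capacity E) * segment_integral (e_out E)
           (\<lambda>x. abs_flux (e_out E) x * (mean_out v E - mean_in v E)\<^sup>2)))"

end

text \<open>
  A Lipschitz field is differentiable almost everywhere (Rademacher), and its divergence is the
  trace of its derivative; it is an almost-everywhere defined function.

  That a triangular cut cell has exactly one inflow and one outflow face is a consequence of the
  assumptions on \<open>\<beta>\<close>, and therefore not assumed.
\<close>

locale dod_setting = dod_data +
  assumes L_pos: "0 < L"
    and x0_pos: "0 < x0" and x0_less: "x0 < L"
    and gamma_pos: "0 < \<gamma>" and gamma_less: "\<gamma> < pi / 2"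
    and ramp_below_top: "(L - x0) * tan \<gamma> < L"
    and h_pos: "0 < h"
    and h_divides: "\<exists>N::nat. L = real N * h"
    and tau_pos: "0 < \<tau>"
    and beta_lipschitz: "\<exists>C. C-lipschitz_on (closure \<Omega>) \<beta>"
    and beta_div_free:
      "AE x in lebesgue_on \<Omega>. \<exists>D. (\<beta> has_derivative D) (at x) \<and> (\<Sum>b\<in>Basis. D b \<bullet> b) = 0"
    and beta_tangential: "\<And>x. x \<in> ramp \<Longrightarrow> \<beta> x \<bullet> ramp_normal = 0"
    and beta_nonzero: "\<And>x. x \<in> ramp \<Longrightarrow> \<beta> x \<noteq> 0"
    and beta_sign: "\<And>E e. face_of_cell e E \<Longrightarrow>
      (\<forall>x\<in>e. \<beta> x \<bullet> outer_normal E e \<ge> 0) \<or> (\<forall>x\<in>e. \<beta> x \<bullet> outer_normal E e \<le> 0)"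
    and stabilized_not_boundary:
      "\<And>E. E \<in> stabilized \<Longrightarrow> e_in E \<notin> boundary_faces \<and> e_out E \<notin> boundary_faces"

end

theory Submission
  imports Defs
begin

text \<open>
  On a face with constant upwind direction the upwind term equals half the weighted squared jump
  plus half the sum of \<open>v\<^sup>2\<close> times the outward flux of \<open>\<beta>\<close> over the adjacent cells. Summed over
  all faces the latter terms vanish, because \<open>\<beta>\<close> has no net flux through the boundary of a cell.
  For a stabilized cell, inflow and outflow have the same flux \<open>F\<close>, since \<open>\<beta>\<close> is tangential to the
  ramp; the stabilization then contributes \<open>-(1 - \<alpha>) F (v - v_in) (v - v_out)\<close>, which is matched to
  the seminorm by \<open>2 a b = a\<^sup>2 + b\<^sup>2 - (a - b)\<^sup>2\<close>.

  The divergence theorem on a cell is obtained for a Lipschitz field by passing to the limit in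
  difference quotients: Fubini and a one-dimensional mean value estimate give the boundary
  integrals, dominated convergence and the almost everywhere derivative give the divergence.
\<close>

section \<open>Divergence theorem on a cut cell for Lipschitz fields\<close>

text \<open>Once every face integral is a flux times a number, the identity is short algebra; most
  of the work justifies that reduction. Two facts used above are consequences, not hypotheses. The
  flux balance must be derived although the divergence is known only almost everywhere and the shape
  of a cut cell varies. That a triangle has one inflow and one outflow face comes from the slope:
  since 0 < \<gamma> < pi/2 and the domain lies above the ramp, the legs of every triangle are its
  left and top sides, and \<beta> at the left end of the hypotenuse is a nonzero vector along the
  ramp, so it crosses the left leg. The same orientation prevents two triangles from sharing a leg,
  so the stabilization terms do not interact. All cells, cut or not, are described by the same five
  half-planes; sides that vanish or shrink to a point count with flux 0, which avoids cases by
  shape. As \<beta> \<bullet> n has constant sign on a face, the sign of the flux decides between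
  inflow and outflow. Where the flux is 0 the weighted mean is a default value, but it is always
  multiplied by that flux.\<close>

lemma integrable_indicator_times_continuous:
  fixes g :: "'a::euclidean_space \<Rightarrow> real"
  assumes "A \<in> sets borel" "bounded A" "continuous_on UNIV g"
  shows "integrable lborel (\<lambda>x. indicator A x * g x)"
proof -
  have K: "compact (closure A)"
    using assms(2) by simp
  then have "bounded (g ` closure A)"
    by (meson assms(3) compact_continuous_image compact_imp_bounded continuous_on_subset subset_UNIV)
  then obtain B where B: "\<And>x. x \<in> closure A \<Longrightarrow> \<bar>g x\<bar> \<le> B"
    by (auto simp: bounded_iff)
  have m: "g \<in> borel_measurable borel"
    using assms(3) by (simp add: borel_measurable_continuous_onI)
  show ?thesis
  proof (rule integrableI_bounded_set[where A = A and B = B])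
    show "A \<in> sets lborel" using assms by simp
    show "(\<lambda>x. indicator A x * g x) \<in> borel_measurable lborel"
      using assms(1) m by auto
    show "emeasure lborel A < \<infinity>"
      using assms(2) emeasure_bounded_finite by blast
    show "AE x in lborel. x \<in> A \<longrightarrow> norm (indicator A x * g x) \<le> B"
      using B closure_subset by (intro AE_I2) (auto simp: indicator_def)
    show "AE x in lborel. x \<notin> A \<longrightarrow> indicator A x * g x = 0"
      by (intro AE_I2) auto
  qed
qed

text \<open>For an antiderivative \<Phi> of \<phi> the integral telescopes to the difference of the
  means of \<phi> over \<open>[hi, hi + \<delta>]\<close> and \<open>[lo, lo + \<delta>]\<close>;
  each mean is within C \<delta> of the value at the left end of its interval. The bound does not
  depend on \<open>hi - lo\<close>, so it can be integrated over slices of varying length.\<close>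

lemma difference_quotient_integral_close:
  fixes \<phi> :: "real \<Rightarrow> real"
  assumes lip: "\<And>x y. \<bar>\<phi> x - \<phi> y\<bar> \<le> C * \<bar>x - y\<bar>" and "lo \<le> hi" "0 < \<delta>"
  shows "\<bar>(LINT x|lborel. indicator {lo<..<hi} x * ((\<phi> (x + \<delta>) - \<phi> x) / \<delta>)) - (\<phi> hi - \<phi> lo)\<bar> \<le> 2 * C * \<delta>"
proof -
  have C0: "0 \<le> C" using lip[of 0 1] by auto
  have "C-lipschitz_on UNIV \<phi>"
    using lip C0 by (intro lipschitz_onI) (auto simp: dist_real_def)
  then have cont: "continuous_on A \<phi>" for A
    using lipschitz_on_continuous_on continuous_on_subset by blast
  \<comment> \<open>The margin of 1 makes every point of \<open>[lo, hi + \<delta>]\<close>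
    interior, so derivatives within the interval become ordinary ones.\<close>
  obtain \<Phi> where \<Phi>: "\<And>x. x \<in> {lo - 1..hi + \<delta> + 1} \<Longrightarrow>
      (\<Phi> has_vector_derivative \<phi> x) (at x within {lo - 1..hi + \<delta> + 1})"
    using antiderivative_continuous[OF cont] by blast
  have D: "DERIV \<Phi> x :> \<phi> x" if "lo - 1 < x" "x < hi + \<delta> + 1" for x
  proof -
    have "at x within {lo - 1..hi + \<delta> + 1} = at x"
      using that by (simp add: at_within_Icc_at)
    then show ?thesis
      using \<Phi>[of x] that by (simp add: has_real_derivative_iff_has_vector_derivative)
  qed
  have 1: "(LINT x|lborel. ((\<phi> (x + \<delta>) - \<phi> x) / \<delta>) * indicator {lo..hi} x)
      = (\<Phi> (hi + \<delta>) - \<Phi> hi) / \<delta> - (\<Phi> (lo + \<delta>) - \<Phi> lo) / \<delta>"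
  proof (rule integral_FTC_Icc_real)
    show "lo \<le> hi" by fact
    fix x assume x: "lo \<le> x" "x \<le> hi"
    have "((\<lambda>x. \<Phi> (x + \<delta>)) has_real_derivative \<phi> (x + \<delta>)) (at x)"
      using D[of "x + \<delta>"] x assms(3) by (simp add: DERIV_shift)
    then show "((\<lambda>x. (\<Phi> (x + \<delta>) - \<Phi> x) / \<delta>) has_real_derivative ((\<phi> (x + \<delta>) - \<phi> x) / \<delta>)) (at x)"
      using D[of x] x assms(3) by (intro DERIV_cdivide DERIV_diff) auto
    have "continuous_on UNIV (\<lambda>x. (\<phi> (x + \<delta>) - \<phi> x) / \<delta>)"
      using assms(3) by (intro continuous_intros continuous_on_compose2[OF cont[of UNIV]] cont) auto
    then show "isCont (\<lambda>x. (\<phi> (x + \<delta>) - \<phi> x) / \<delta>) x"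
      by (simp add: continuous_on_eq_continuous_at)
  qed
  have 2: "(LINT x|lborel. indicator {lo<..<hi} x * ((\<phi> (x + \<delta>) - \<phi> x) / \<delta>)) =
    (LINT x|lborel. ((\<phi> (x + \<delta>) - \<phi> x) / \<delta>) * indicator {lo..hi} x)"
  proof (rule integral_cong_AE)
    have [measurable]: "\<phi> \<in> borel_measurable borel"
      using cont by (simp add: borel_measurable_continuous_onI)
    show "(\<lambda>x. indicator {lo<..<hi} x * ((\<phi> (x + \<delta>) - \<phi> x) / \<delta>)) \<in> borel_measurable lborel"
      "(\<lambda>x. ((\<phi> (x + \<delta>) - \<phi> x) / \<delta>) * indicator {lo..hi} x) \<in> borel_measurable lborel"
      by measurable
    show "AE x in lborel. indicator {lo<..<hi} x * ((\<phi> (x + \<delta>) - \<phi> x) / \<delta>)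
        = ((\<phi> (x + \<delta>) - \<phi> x) / \<delta>) * indicator {lo..hi} x"
      using AE_lborel_singleton[of lo] AE_lborel_singleton[of hi]
      by eventually_elim (auto simp: indicator_def)
  qed
  have mvt: "\<bar>(\<Phi> (u + \<delta>) - \<Phi> u) / \<delta> - \<phi> u\<bar> \<le> C * \<delta>" if "lo \<le> u" "u \<le> hi" for u
  proof -
    have "u < u + \<delta>" using assms(3) by simp
    moreover have "DERIV \<Phi> x :> \<phi> x" if "u \<le> x" "x \<le> u + \<delta>" for x
      using D[of x] that \<open>lo \<le> u\<close> \<open>u \<le> hi\<close> by simp
    ultimately obtain z where z: "u < z" "z < u + \<delta>" "\<Phi> (u + \<delta>) - \<Phi> u = (u + \<delta> - u) * \<phi> z"
      using MVT2[of u "u + \<delta>" \<Phi> \<phi>] by blast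
    then have "(\<Phi> (u + \<delta>) - \<Phi> u) / \<delta> = \<phi> z" using assms(3) by simp
    moreover have "\<bar>\<phi> z - \<phi> u\<bar> \<le> C * \<delta>"
      using lip[of z u] z C0 by (smt (verit) mult_left_mono)
    ultimately show ?thesis by simp
  qed
  show ?thesis
    unfolding 2 1 using mvt[of lo] mvt[of hi] assms(2) by (simp add: abs_le_iff algebra_simps)
qed

text \<open>Fubini over vertical slices: the error on each slice is at most 2 C \<delta>, and the
  slices range over an interval of length \<open>r - l\<close>. The order of \<open>lo\<close> and
  \<open>hi\<close> is asked only strictly between l and r, because the functions used for a cut
  cell may cross outside that range.\<close>

lemma vertical_quotient_integral_close:
  fixes f :: "plane \<Rightarrow> real"
  assumes lip: "C-lipschitz_on UNIV f"
    and lo: "continuous_on UNIV lo" and hi: "continuous_on UNIV hi"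
    and le: "\<And>x. l < x \<Longrightarrow> x < r \<Longrightarrow> lo x \<le> hi x"
    and "l \<le> r" "0 < \<delta>"
  defines "E \<equiv> {(x, y). l < x \<and> x < r \<and> lo x < y \<and> y < hi x}"
  shows "\<bar>(LINT p|lborel. indicator E p * ((f (p + (0, \<delta>)) - f p) / \<delta>))
      - (LINT x|lborel. indicator {l<..<r} x * (f (x, hi x) - f (x, lo x)))\<bar> \<le> 2 * C * \<delta> * (r - l)"
proof -
  have contf: "continuous_on UNIV f"
    using lip lipschitz_on_continuous_on by blast
  have cont_comp: "continuous_on UNIV (\<lambda>x. f (u x, w x))"
    if "continuous_on UNIV u" "continuous_on UNIV w" for u w :: "real \<Rightarrow> real"
    using that by (intro continuous_on_compose2[OF contf] continuous_intros) auto
  have opE: "open E"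
    unfolding E_def case_prod_beta
    by (intro open_Collect_conj open_Collect_less continuous_intros
        continuous_on_compose2[OF lo] continuous_on_compose2[OF hi]) auto
  have "\<exists>K. \<forall>x\<in>{l..r}. \<bar>lo x\<bar> \<le> K"
    using compact_imp_bounded[OF compact_continuous_image[OF continuous_on_subset[OF lo subset_UNIV], of "{l..r}"]]
    by (auto simp: bounded_iff)
  then obtain K1 where K1: "\<And>x. x \<in> {l..r} \<Longrightarrow> \<bar>lo x\<bar> \<le> K1"
    by blast
  have "\<exists>K. \<forall>x\<in>{l..r}. \<bar>hi x\<bar> \<le> K"
    using compact_imp_bounded[OF compact_continuous_image[OF continuous_on_subset[OF hi subset_UNIV], of "{l..r}"]]
    by (auto simp: bounded_iff)
  then obtain K2 where K2: "\<And>x. x \<in> {l..r} \<Longrightarrow> \<bar>hi x\<bar> \<le> K2"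
    by blast
  have "E \<subseteq> {l..r} \<times> {- K1..K2}"
  proof
    fix p assume "p \<in> E"
    then obtain x y where p: "p = (x, y)" "l < x" "x < r" "lo x < y" "y < hi x"
      by (auto simp: E_def)
    then show "p \<in> {l..r} \<times> {- K1..K2}" using K1[of x] K2[of x] by auto
  qed
  then have bE: "bounded E"
    by (rule bounded_subset[rotated]) (simp add: bounded_Times)
  define D where "D = (\<lambda>p. indicator E p * ((f (p + (0, \<delta>)) - f p) / \<delta>))"
  have contD: "continuous_on UNIV (\<lambda>p. (f (p + (0, \<delta>)) - f p) / \<delta>)"
    using assms(6) by (intro continuous_intros continuous_on_compose2[OF contf]) auto
  have D_int: "integrable (lborel \<Otimes>\<^sub>M lborel) D"
    unfolding D_def lborel_prod
    by (rule integrable_indicator_times_continuous[OF _ bE contD]) (use opE in auto)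
  have D_eq: "D (x, y) = indicator {l<..<r} x *
      (indicator {lo x<..<hi x} y * ((f (x, y + \<delta>) - f (x, y)) / \<delta>))" for x y
    by (auto simp: D_def E_def indicator_def)
  define G where "G = (\<lambda>x. LINT y|lborel. D (x, y))"
  define H where "H = (\<lambda>x. indicator {l<..<r} x * (f (x, hi x) - f (x, lo x)))"
  have G_int: "integrable lborel G"
    unfolding G_def by (rule lborel_pair.integrable_fst'[OF D_int])
  have H_int: "integrable lborel H"
    unfolding H_def
    by (intro integrable_indicator_times_continuous continuous_intros cont_comp lo hi) auto
  have GH: "\<bar>G x - H x\<bar> \<le> indicator {l<..<r} x * (2 * C * \<delta>)" for x
  proof (cases "x \<in> {l<..<r}")
    case True
    have "\<bar>f (x, a) - f (x, b)\<bar> \<le> C * \<bar>a - b\<bar>" for a b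
      using lipschitz_onD[OF lip, of "(x, a)" "(x, b)"] by (simp add: dist_Pair_Pair dist_real_def)
    from difference_quotient_integral_close[of "\<lambda>y. f (x, y)", OF this le assms(6)] True
    show ?thesis by (simp add: G_def H_def D_eq)
  next
    case False
    then show ?thesis by (simp add: G_def H_def D_eq)
  qed
  have "\<bar>(LINT x|lborel. G x - H x)\<bar> \<le> (LINT x|lborel. \<bar>G x - H x\<bar>)"
    using integral_norm_bound[of lborel "\<lambda>x. G x - H x"] by simp
  also have "\<dots> \<le> (LINT x|lborel. indicator {l<..<r} x * (2 * C * \<delta>))"
  proof (rule integral_mono)
    show "integrable lborel (\<lambda>x. indicator {l<..<r} x * (2 * C * \<delta>))"
      by (rule integrable_indicator_times_continuous) auto
  qed (use GH G_int H_int in auto)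
  also have "\<dots> = 2 * C * \<delta> * (r - l)"
    using assms(5) by simp
  finally have "\<bar>(LINT x|lborel. G x) - (LINT x|lborel. H x)\<bar> \<le> 2 * C * \<delta> * (r - l)"
    using G_int H_int by simp
  moreover have "(LINT x|lborel. G x) = (LINT p|lborel. D p)"
    unfolding G_def using lborel_pair.integral_fst'[OF D_int] by (simp add: lborel_prod)
  ultimately show ?thesis unfolding D_def H_def by argo
qed

lemma lborel_integral_swap:
  fixes F :: "plane \<Rightarrow> real"
  assumes "F \<in> borel_measurable borel"
  shows "(LINT p|lborel. F (prod.swap p)) = (LINT p|lborel. F p)"
proof -
  have "(\<lambda>p. F (prod.swap p)) = (\<lambda>(x, y). F (y, x))" by auto
  then show ?thesis
    using lborel_pair.integral_product_swap[of F] assms by (simp add: lborel_prod)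
qed

text \<open>Reflection in the diagonal reduces this to vertical slices; \<open>prod.swap\<close>
  preserves Lebesgue measure and distances.\<close>

lemma horizontal_quotient_integral_close:
  fixes f :: "plane \<Rightarrow> real"
  assumes lip: "C-lipschitz_on UNIV f"
    and lo: "continuous_on UNIV lo" and hi: "continuous_on UNIV hi"
    and le: "\<And>y. l < y \<Longrightarrow> y < r \<Longrightarrow> lo y \<le> hi y"
    and "l \<le> r" "0 < \<delta>"
  defines "E \<equiv> {(x, y). l < y \<and> y < r \<and> lo y < x \<and> x < hi y}"
  shows "\<bar>(LINT p|lborel. indicator E p * ((f (p + (\<delta>, 0)) - f p) / \<delta>))
      - (LINT y|lborel. indicator {l<..<r} y * (f (hi y, y) - f (lo y, y)))\<bar> \<le> 2 * C * \<delta> * (r - l)"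
proof -
  define f' where "f' = (\<lambda>p. f (prod.swap p))"
  have lip': "C-lipschitz_on UNIV f'"
  proof (rule lipschitz_onI)
    show "0 \<le> C" using lip lipschitz_on_nonneg by blast
    fix p q :: plane
    show "dist (f' p) (f' q) \<le> C * dist p q"
      using lipschitz_onD[OF lip, of "prod.swap p" "prod.swap q"]
      by (cases p; cases q) (simp add: f'_def dist_Pair_Pair add.commute)
  qed
  define E' where "E' = {(x, y). l < x \<and> x < r \<and> lo x < y \<and> y < hi x}"
  have opE: "open E"
    unfolding E_def case_prod_beta
    by (intro open_Collect_conj open_Collect_less continuous_intros
        continuous_on_compose2[OF lo] continuous_on_compose2[OF hi]) auto
  then have [measurable]: "E \<in> sets borel" by simp
  have [measurable]: "f \<in> borel_measurable borel"
    using lip lipschitz_on_continuous_on borel_measurable_continuous_onI by blast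
  have "(LINT p|lborel. indicator E p * ((f (p + (\<delta>, 0)) - f p) / \<delta>)) =
     (LINT p|lborel. indicator E (prod.swap p) * ((f (prod.swap p + (\<delta>, 0)) - f (prod.swap p)) / \<delta>))"
    by (rule lborel_integral_swap[symmetric]) measurable
  also have "\<dots> = (LINT p|lborel. indicator E' p * ((f' (p + (0, \<delta>)) - f' p) / \<delta>))"
    by (rule Bochner_Integration.integral_cong)
      (auto simp: E_def E'_def f'_def indicator_def)
  finally have eq: "(LINT p|lborel. indicator E p * ((f (p + (\<delta>, 0)) - f p) / \<delta>)) =
    (LINT p|lborel. indicator E' p * ((f' (p + (0, \<delta>)) - f' p) / \<delta>))" .
  have "\<bar>(LINT p|lborel. indicator E' p * ((f' (p + (0, \<delta>)) - f' p) / \<delta>))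
      - (LINT y|lborel. indicator {l<..<r} y * (f' (y, hi y) - f' (y, lo y)))\<bar> \<le> 2 * C * \<delta> * (r - l)"
    using vertical_quotient_integral_close[OF lip' lo hi le assms(5,6)] E'_def by simp
  moreover have "f' (x, y) = f (y, x)" for x y by (simp add: f'_def)
  ultimately show ?thesis
    by (simp only: eq)
qed



text \<open>The Lipschitz condition bounds the quotients by 2 C, which supplies the dominating
  function; at almost every point of E they converge to the trace of the derivative, which is 0. The
  shifted points may leave E, hence g is Lipschitz on the whole plane here, while the pointwise
  limit is local to E.\<close>

lemma divergence_quotient_tendsto:
  fixes g :: "plane \<Rightarrow> plane"
  assumes lip: "C-lipschitz_on UNIV g" and E: "E \<in> sets borel" "bounded E"
    and div: "AE p in lborel. p \<in> E \<longrightarrow> (\<exists>D. (g has_derivative D) (at p) \<and> (\<Sum>b\<in>Basis. D b \<bullet> b) = 0)"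
    and \<delta>: "\<And>n::nat. 0 < \<delta> n" "\<delta> \<longlonglongrightarrow> 0"
  shows "(\<lambda>n. (LINT p|lborel. indicator E p * ((fst (g (p + (\<delta> n, 0))) - fst (g p)) / \<delta> n)) +
      (LINT p|lborel. indicator E p * ((snd (g (p + (0, \<delta> n))) - snd (g p)) / \<delta> n))) \<longlonglongrightarrow> 0"
proof -
  define q where "q = (\<lambda>n p. (fst (g (p + (\<delta> n, 0))) - fst (g p)) / \<delta> n +
      (snd (g (p + (0, \<delta> n))) - snd (g p)) / \<delta> n)"
  have cont: "continuous_on UNIV g"
    using lip lipschitz_on_continuous_on by blast
  have \<delta>0: "\<delta> n \<noteq> 0" for n using \<delta>(1)[of n] by simp
  have ci: "continuous_on UNIV (\<lambda>p. (fst (g (p + (\<delta> n, 0))) - fst (g p)) / \<delta> n)"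
    "continuous_on UNIV (\<lambda>p. (snd (g (p + (0, \<delta> n))) - snd (g p)) / \<delta> n)" for n
    by (auto intro!: continuous_intros continuous_on_compose2[OF cont] simp: \<delta>0)
  note int = integrable_indicator_times_continuous[OF E ci(1)] integrable_indicator_times_continuous[OF E ci(2)]
  have cq: "continuous_on UNIV (q n)" for n
    unfolding q_def by (intro continuous_on_add ci)
  have C0: "0 \<le> C" using lip lipschitz_on_nonneg by blast
  have bound: "\<bar>q n p\<bar> \<le> 2 * C" for n p
  proof -
    have "norm (g (p + v) - g p) \<le> C * norm v" for v
      using lipschitz_onD[OF lip, of "p + v" p] by (simp add: dist_norm)
    from this[of "(\<delta> n, 0)"] this[of "(0, \<delta> n)"] 
    have "norm (g (p + (\<delta> n, 0)) - g p) \<le> C * \<delta> n" "norm (g (p + (0, \<delta> n)) - g p) \<le> C * \<delta> n"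
      using \<delta>(1)[of n] by (auto simp: norm_Pair)
    moreover have "\<bar>fst u\<bar> \<le> norm u" "\<bar>snd u\<bar> \<le> norm u" for u :: plane
      using norm_fst_le[of "fst u" "snd u"] norm_snd_le[of "snd u" "fst u"] by auto
    ultimately have "\<bar>fst (g (p + (\<delta> n, 0))) - fst (g p)\<bar> \<le> C * \<delta> n"
      "\<bar>snd (g (p + (0, \<delta> n))) - snd (g p)\<bar> \<le> C * \<delta> n"
      by (metis fst_diff order_trans, metis snd_diff order_trans)
    then have "\<bar>(fst (g (p + (\<delta> n, 0))) - fst (g p)) / \<delta> n\<bar> \<le> C" 
      "\<bar>(snd (g (p + (0, \<delta> n))) - snd (g p)) / \<delta> n\<bar> \<le> C"
      using \<delta>(1)[of n] by (auto simp: abs_divide pos_divide_le_eq)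
    then show ?thesis unfolding q_def by linarith
  qed
  have lim: "(\<lambda>n. q n p) \<longlonglongrightarrow> (\<Sum>b\<in>Basis. D b \<bullet> b)" if D: "(g has_derivative D) (at p)" for D p
  proof -
    interpret D: bounded_linear D using D by (rule has_derivative_bounded_linear)
    \<comment> \<open>Differentiation along the line through p in direction v; \<pi> will be one of
      the two coordinate projections.\<close>
    have *: "(\<lambda>n. (\<pi> (g (p + \<delta> n *\<^sub>R v)) - \<pi> (g p)) / \<delta> n) \<longlonglongrightarrow> \<pi> (D v)"
      if "bounded_linear \<pi>" for v and \<pi> :: "plane \<Rightarrow> real"
    proof -
      interpret \<pi>: bounded_linear \<pi> by fact
      have "((\<lambda>t. g (p + t *\<^sub>R v)) has_derivative (\<lambda>t. D (t *\<^sub>R v))) (at 0)"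
        by (rule has_derivative_compose[of "\<lambda>t. p + t *\<^sub>R v" "\<lambda>t. t *\<^sub>R v" 0 UNIV g D])
          (auto intro!: derivative_eq_intros simp: D)
      then have "((\<lambda>t. \<pi> (g (p + t *\<^sub>R v))) has_derivative (\<lambda>t. \<pi> (D (t *\<^sub>R v)))) (at 0)"
        by (rule \<pi>.has_derivative)
      moreover have "(\<lambda>t. \<pi> (D (t *\<^sub>R v))) = (*) (\<pi> (D v))"
        by (auto simp: D.scaleR \<pi>.scaleR)
      ultimately have "((\<lambda>t. \<pi> (g (p + t *\<^sub>R v))) has_real_derivative \<pi> (D v)) (at 0)"
        by (simp add: has_field_derivative_def)
      then have "((\<lambda>t. (\<pi> (g (p + t *\<^sub>R v)) - \<pi> (g p)) / t) \<longlongrightarrow> \<pi> (D v)) (at 0)"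
        by (simp add: DERIV_def)
      then show ?thesis
        by (rule filterlim_compose) (auto simp: filterlim_at \<delta> \<delta>0)
    qed
    have "(\<lambda>n. (fst (g (p + \<delta> n *\<^sub>R (1, 0))) - fst (g p)) / \<delta> n + (snd (g (p + \<delta> n *\<^sub>R (0, 1))) - snd (g p)) / \<delta> n)
        \<longlonglongrightarrow> fst (D (1, 0)) + snd (D (0, 1))"
      by (intro tendsto_add * bounded_linear_fst bounded_linear_snd)
    moreover have "(\<Sum>b\<in>Basis. D b \<bullet> b) = fst (D (1, 0)) + snd (D (0, 1))"
    proof -
      have B: "(Basis :: plane set) = {(1, 0), (0, 1)}" by (auto simp: Basis_prod_def)
      show ?thesis unfolding B by (simp add: inner_prod_def)
    qed
    ultimately show ?thesis
      by (simp add: q_def)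
  qed
  have "(\<lambda>n. LINT p|lborel. indicator E p * q n p) \<longlonglongrightarrow> (LINT p|(lborel :: plane measure). 0)"
  proof (rule integral_dominated_convergence[where w = "\<lambda>p. indicator E p * (2 * C)"])
    show "integrable lborel (\<lambda>p. indicator E p * (2 * C))"
      by (rule integrable_indicator_times_continuous[OF E]) auto
    show "(\<lambda>p. indicator E p * q n p) \<in> borel_measurable lborel" for n
      using E cq borel_measurable_continuous_onI by (intro borel_measurable_times) auto
    show "AE p in lborel. (\<lambda>n. indicator E p * q n p) \<longlonglongrightarrow> 0"
      using div
    proof eventually_elim
      case (elim p)
      show ?case
      proof (cases "p \<in> E")
        case True
        then obtain D where "(g has_derivative D) (at p)" "(\<Sum>b\<in>Basis. D b \<bullet> b) = 0"
          using elim by blast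
        with lim[of D p] show ?thesis using True by simp
      qed simp
    qed
    show "AE p in lborel. norm (indicator E p * q n p) \<le> indicator E p * (2 * C)" for n
      using bound[of n] by (intro AE_I2) (auto simp: indicator_def)
  qed simp
  moreover have "(LINT p|lborel. indicator E p * q n p) =
      (LINT p|lborel. indicator E p * ((fst (g (p + (\<delta> n, 0))) - fst (g p)) / \<delta> n)) +
      (LINT p|lborel. indicator E p * ((snd (g (p + (0, \<delta> n))) - snd (g p)) / \<delta> n))" for n
    unfolding q_def distrib_left by (rule Bochner_Integration.integral_add[OF int])
  ultimately show ?thesis by simp
qed

text \<open>The nearest-point projection onto a closed convex set is nonexpansive, so the extension
  keeps the constant C.\<close>

lemma lipschitz_on_closest_point:
  fixes g :: "'a::euclidean_space \<Rightarrow> 'b::metric_space"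
  assumes "C-lipschitz_on S g" "convex S" "closed S" "S \<noteq> {}"
  shows "C-lipschitz_on UNIV (\<lambda>x. g (closest_point S x))"
proof (rule lipschitz_onI)
  show "0 \<le> C" using assms(1) lipschitz_on_nonneg by blast
  then show "dist (g (closest_point S x)) (g (closest_point S y)) \<le> C * dist x y" for x y
    using lipschitz_onD[OF assms(1), of "closest_point S x" "closest_point S y"]
      closest_point_in_set[OF assms(3,4)] closest_point_lipschitz[OF assms(2-4), of x y]
    by (meson mult_left_mono order_trans)
qed

text \<open>The cell lies between two graphs in either coordinate direction, so both slice estimates
  apply to the same set. \<open>corner\<close> puts the top left vertex above the ramp line, which
  makes both ranges of slices nonempty; \<open>max\<close> and \<open>min\<close> mark where the
  boundary turns from a side of the box into the ramp.\<close>

lemma cut_cell_divergence: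
  fixes g :: "plane \<Rightarrow> plane"
  assumes lip: "C-lipschitz_on UNIV g" and ab: "a < b" and cd: "c < d" and m: "0 < m"
    and corner: "(a - x0) * m < d"
  defines "E \<equiv> {(x, y). a < x \<and> x < b \<and> c < y \<and> y < d \<and> (x - x0) * m < y}"
  assumes div: "AE p in lborel. p \<in> E \<longrightarrow> (\<exists>D. (g has_derivative D) (at p) \<and> (\<Sum>b\<in>Basis. D b \<bullet> b) = 0)"
  shows "(LINT y|lborel. indicator {max c ((a - x0) * m)<..<d} y *
          (fst (g (min b (x0 + y / m), y)) - fst (g (a, y)))) +
      (LINT x|lborel. indicator {a<..<min b (x0 + d / m)} x *
          (snd (g (x, d)) - snd (g (x, max c ((x - x0) * m))))) = 0"
    (is "?H + ?V = 0")
proof -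
  define \<delta> :: "nat \<Rightarrow> real" where "\<delta> = (\<lambda>n. inverse (real (Suc n)))"
  have \<delta>: "0 < \<delta> n" for n by (simp add: \<delta>_def)
  have \<delta>0: "\<delta> \<longlonglongrightarrow> 0" unfolding \<delta>_def by (rule LIMSEQ_inverse_real_of_nat)
  have lip1: "C-lipschitz_on UNIV (\<lambda>p. fst (g p))"
    and lip2: "C-lipschitz_on UNIV (\<lambda>p. snd (g p))"
    using lipschitz_onD[OF lip] lipschitz_on_nonneg[OF lip]
    by (auto intro!: lipschitz_onI intro: order_trans[OF dist_fst_le] order_trans[OF dist_snd_le])
  have E1: "E = {(x, y). max c ((a - x0) * m) < y \<and> y < d \<and> a < x \<and> x < min b (x0 + y / m)}"
  proof -
    have "(x - x0) * m < y \<longleftrightarrow> x < x0 + y / m" for x y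
      using m by (simp add: field_simps)
    moreover have "(a - x0) * m < (x - x0) * m" if "a < x" for x
      using m that by simp
    ultimately show ?thesis unfolding E_def by fastforce
  qed
  have E2: "E = {(x, y). a < x \<and> x < min b (x0 + d / m) \<and> max c ((x - x0) * m) < y \<and> y < d}"
  proof -
    have "(x - x0) * m < d \<longleftrightarrow> x < x0 + d / m" for x
      using m by (simp add: field_simps)
    then show ?thesis unfolding E_def by fastforce
  qed
  have opE: "open E"
    unfolding E_def case_prod_beta
    by (intro open_Collect_conj open_Collect_less continuous_intros)
  have "E \<subseteq> cbox (a, c) (b, d)"
    unfolding E_def by (auto simp: mem_box Basis_prod_def)
  then have bE: "bounded E"
    using bounded_cbox bounded_subset by blast
  have lim: "(\<lambda>n. 2 * C * \<delta> n * K) \<longlonglongrightarrow> 0" for K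
    using tendsto_mult[OF tendsto_mult[OF tendsto_const[of "2 * C"] \<delta>0] tendsto_const[of K]] by simp
  have limI: "F \<longlonglongrightarrow> G" if "\<And>n. \<bar>F n - G\<bar> \<le> 2 * C * \<delta> n * K" for F G K
  proof -
    have "(\<lambda>n. F n - G) \<longlonglongrightarrow> 0"
      using that by (intro Lim_null_comparison[OF _ lim[of K]]) auto
    then show ?thesis using LIM_zero_iff by blast
  qed
  have H: "(\<lambda>n. LINT p|lborel. indicator E p * ((fst (g (p + (\<delta> n, 0))) - fst (g p)) / \<delta> n)) \<longlonglongrightarrow> ?H"
    unfolding E1
  proof (rule limI, rule horizontal_quotient_integral_close[OF lip1])
    show "a \<le> min b (x0 + y / m)" if "max c ((a - x0) * m) < y" for y
      using ab m that by (simp add: field_simps)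
    show "continuous_on UNIV (\<lambda>y. min b (x0 + y / m))"
      using m by (intro continuous_intros) auto
  qed (use cd corner \<delta> in auto)
  have V: "(\<lambda>n. LINT p|lborel. indicator E p * ((snd (g (p + (0, \<delta> n))) - snd (g p)) / \<delta> n)) \<longlonglongrightarrow> ?V"
    unfolding E2
  proof (rule limI, rule vertical_quotient_integral_close[OF lip2])
    show "max c ((x - x0) * m) \<le> d" if "x < min b (x0 + d / m)" for x
      using cd m that by (simp add: field_simps)
    show "a \<le> min b (x0 + d / m)"
      using ab m corner by (simp add: field_simps)
    show "continuous_on UNIV (\<lambda>x. max c ((x - x0) * m))"
      by (intro continuous_intros)
  qed (use \<delta> in auto)
  have "(\<lambda>n. (LINT p|lborel. indicator E p * ((fst (g (p + (\<delta> n, 0))) - fst (g p)) / \<delta> n)) +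
      (LINT p|lborel. indicator E p * ((snd (g (p + (0, \<delta> n))) - snd (g p)) / \<delta> n))) \<longlonglongrightarrow> 0"
    using opE by (intro divergence_quotient_tendsto[OF lip _ bE div \<delta> \<delta>0]) simp
  from LIMSEQ_unique[OF tendsto_add[OF H V] this] show ?thesis .
qed



section \<open>Separating the ramp from the axis-parallel sides\<close>

lemma indicator_integral_cong_AE:
  fixes f g :: "real \<Rightarrow> real"
  assumes "A \<in> sets borel" "B \<in> sets borel" "continuous_on UNIV f" "finite N"
    and "\<And>x. x \<notin> N \<Longrightarrow> x \<in> A \<longleftrightarrow> x \<in> B"
  shows "(LINT x|lborel. indicator A x * f x) = (LINT x|lborel. indicator B x * f x)"
proof (rule integral_cong_AE)
  have [measurable]: "f \<in> borel_measurable borel"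
    using assms(3) by (simp add: borel_measurable_continuous_onI)
  show "(\<lambda>x. indicator A x * f x) \<in> borel_measurable lborel"
    "(\<lambda>x. indicator B x * f x) \<in> borel_measurable lborel"
    using assms(1,2) by auto
  have "AE x in lborel. x \<notin> N"
    using assms(4) by (simp add: AE_not_in finite_imp_null_set_lborel)
  then show "AE x in lborel. indicator A x * f x = indicator B x * f x"
    by eventually_elim (use assms(5) in \<open>auto simp: indicator_def\<close>)
qed

text \<open>Made for integrands containing \<open>min\<close> or \<open>max\<close>: f' and f'' are
  the two branches, A and B the ranges where they apply, and N holds the point of transition, which
  may belong to neither range.\<close>

lemma indicator_integral_split:
  fixes f :: "real \<Rightarrow> real"
  assumes "A \<in> sets borel" "B \<in> sets borel" "bounded A" "bounded B"
    and "continuous_on UNIV f" "continuous_on UNIV f'" "continuous_on UNIV f''"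
    and "finite N" "A \<inter> B = {}"
    and "\<And>x. x \<notin> N \<Longrightarrow> x \<in> C \<longleftrightarrow> x \<in> A \<or> x \<in> B"
    and "C \<in> sets borel"
    and "\<And>x. x \<in> A \<Longrightarrow> f x = f' x" "\<And>x. x \<in> B \<Longrightarrow> f x = f'' x"
  shows "(LINT x|lborel. indicator C x * f x) =
    (LINT x|lborel. indicator A x * f' x) + (LINT x|lborel. indicator B x * f'' x)"
proof -
  have "(LINT x|lborel. indicator C x * f x) = (LINT x|lborel. indicator (A \<union> B) x * f x)"
    by (rule indicator_integral_cong_AE[where N = N]) (use assms in auto)
  also have "\<dots> = (LINT x|lborel. indicator A x * f' x + indicator B x * f'' x)"
    using assms(9,12,13) by (intro Bochner_Integration.integral_cong) (auto simp: indicator_def)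
  also have "\<dots> = (LINT x|lborel. indicator A x * f' x) + (LINT x|lborel. indicator B x * f'' x)"
    by (rule Bochner_Integration.integral_add) (use assms in \<open>auto intro!: integrable_indicator_times_continuous\<close>)
  finally show ?thesis .
qed

text \<open>The ramp part of the boundary occurs in both slice integrals, once as a graph over y and
  once as a graph over x. The substitution y = (x - x0) m carries one into the other, and tangency
  makes them cancel.\<close>

lemma cut_cell_flux_extended:
  fixes g :: "plane \<Rightarrow> plane"
  assumes lip: "C-lipschitz_on UNIV g" and ab: "a < b" and cd: "c < d" and m: "0 < m"
    and corner: "(a - x0) * m < d"
  defines "E \<equiv> {(x, y). a < x \<and> x < b \<and> c < y \<and> y < d \<and> (x - x0) * m < y}"
  assumes div: "AE p in lborel. p \<in> E \<longrightarrow> (\<exists>D. (g has_derivative D) (at p) \<and> (\<Sum>b\<in>Basis. D b \<bullet> b) = 0)"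
    and tangential: "\<And>x. a < x \<Longrightarrow> x < b \<Longrightarrow> c < (x - x0) * m \<Longrightarrow> (x - x0) * m < d \<Longrightarrow>
      m * fst (g (x, (x - x0) * m)) = snd (g (x, (x - x0) * m))"
  shows "(LINT y|lborel. indicator {max c ((b - x0) * m)<..<d} y * fst (g (b, y))) -
      (LINT y|lborel. indicator {max c ((a - x0) * m)<..<d} y * fst (g (a, y))) +
      (LINT x|lborel. indicator {a<..<min b (x0 + d / m)} x * snd (g (x, d))) -
      (LINT x|lborel. indicator {a<..<min b (x0 + c / m)} x * snd (g (x, c))) = 0"
    (is "?R - ?L + ?T - ?B = 0")
proof -
  have contg: "continuous_on UNIV (\<lambda>x. g (u x, w x))"
    if "continuous_on UNIV u" "continuous_on UNIV w" for u w :: "real \<Rightarrow> real"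
    by (rule continuous_on_compose2[OF lipschitz_on_continuous_on[OF lip] continuous_on_Pair[OF that]]) simp
  note cont = continuous_intros contg
  \<comment> \<open>\<open>Rx\<close> and \<open>Ry\<close> are the projections to the axes of the
    piece of the ramp line inside the open box.\<close>
  define Rx where "Rx = {x. a < x \<and> x < b \<and> c < (x - x0) * m \<and> (x - x0) * m < d}"
  define Ry where "Ry = {y. max c ((a - x0) * m) < y \<and> y < d \<and> y < (b - x0) * m}"
  have b_x: "bounded Rx" by (rule bounded_subset[of "{a..b}"]) (auto simp: Rx_def)
  have b_y: "bounded Ry" by (rule bounded_subset[of "{c..d}"]) (auto simp: Ry_def)
  have mx: "Rx \<in> sets borel"
    unfolding Rx_def by measurable
  have my: "Ry \<in> sets borel"
    unfolding Ry_def by measurable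
  have div_m: "x < x0 + y / m \<longleftrightarrow> (x - x0) * m < y" "x0 + y / m < x \<longleftrightarrow> y < (x - x0) * m"
    "x \<le> x0 + y / m \<longleftrightarrow> (x - x0) * m \<le> y" for x y
    using m by (simp_all add: field_simps)
  have mono: "(x - x0) * m < (x' - x0) * m \<longleftrightarrow> x < x'" for x x'
    using m by simp
  have 1: "(LINT y|lborel. indicator {max c ((a - x0) * m)<..<d} y *
          (fst (g (min b (x0 + y / m), y)))) =
      ?R + (LINT y|lborel. indicator Ry y * fst (g (x0 + y / m, y)))"
  proof (rule indicator_integral_split[where N = "{(b - x0) * m}"])
    show "y \<in> {max c ((a - x0) * m)<..<d} \<longleftrightarrow> y \<in> {max c ((b - x0) * m)<..<d} \<or> y \<in> Ry"
      if "y \<notin> {(b - x0) * m}" for y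
      using that mono[of a b] ab by (auto simp: Ry_def)
    show "fst (g (min b (x0 + y / m), y)) = fst (g (b, y))" if "y \<in> {max c ((b - x0) * m)<..<d}" for y
      using that div_m(1)[of b y] by (simp add: min_def)
    show "fst (g (min b (x0 + y / m), y)) = fst (g (x0 + y / m, y))" if "y \<in> Ry" for y
      using that div_m(2)[of y b] by (simp add: min_def Ry_def)
  qed (use m my b_y in \<open>auto intro!: cont simp: Ry_def\<close>)
  have 2: "(LINT x|lborel. indicator {a<..<min b (x0 + d / m)} x * snd (g (x, max c ((x - x0) * m)))) =
      ?B + (LINT x|lborel. indicator Rx x * snd (g (x, (x - x0) * m)))"
  proof (rule indicator_integral_split[where N = "{x0 + c / m}"])
    show "x \<in> {a<..<min b (x0 + d / m)} \<longleftrightarrow> x \<in> {a<..<min b (x0 + c / m)} \<or> x \<in> Rx"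
      if "x \<notin> {x0 + c / m}" for x
      using that cd by (auto simp: Rx_def div_m min_less_iff_conj)
        (metis div_m(1,2) linorder_neqE)+
    show "snd (g (x, max c ((x - x0) * m))) = snd (g (x, c))" if "x \<in> {a<..<min b (x0 + c / m)}" for x
      using that div_m(1)[of x c] by (simp add: max_def)
    show "snd (g (x, max c ((x - x0) * m))) = snd (g (x, (x - x0) * m))" if "x \<in> Rx" for x
      using that by (simp add: max_def Rx_def)
    show "{a<..<min b (x0 + c / m)} \<inter> Rx = {}"
      by (auto simp: Rx_def div_m)
  qed (use m mx b_x in \<open>auto intro!: cont\<close>)
  have 3: "(LINT y|lborel. indicator Ry y * fst (g (x0 + y / m, y))) =
      (LINT x|lborel. indicator Rx x * snd (g (x, (x - x0) * m)))"
  proof -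
    have "(LINT y|lborel. indicator Ry y * fst (g (x0 + y / m, y))) =
      \<bar>m\<bar> *\<^sub>R (LINT x|lborel. indicator Ry (- x0 * m + m * x) * fst (g (x0 + (- x0 * m + m * x) / m, - x0 * m + m * x)))"
      using m by (intro lborel_integral_real_affine) auto
    also have "\<dots> = (LINT x|lborel. m * (indicator Ry (- x0 * m + m * x) * fst (g (x0 + (- x0 * m + m * x) / m, - x0 * m + m * x))))"
      using m by simp
    also have "\<dots> = (LINT x|lborel. indicator Rx x * snd (g (x, (x - x0) * m)))"
    proof (rule Bochner_Integration.integral_cong)
      fix x
      have e: "- x0 * m + m * x = (x - x0) * m" "x0 + (x - x0) * m / m = x"
        using m by (simp_all add: left_diff_distrib mult.commute[of m x]) (simp add: left_diff_distrib[symmetric])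
      have "(x - x0) * m \<in> Ry \<longleftrightarrow> x \<in> Rx"
        by (auto simp: Ry_def Rx_def mono)
      then show "m * (indicator Ry (- x0 * m + m * x) * fst (g (x0 + (- x0 * m + m * x) / m, - x0 * m + m * x)))
        = indicator Rx x * snd (g (x, (x - x0) * m))"
        unfolding e using tangential[of x] by (auto simp: indicator_def Rx_def)
    qed simp
    finally show ?thesis .
  qed
  have "(LINT y|lborel. indicator {max c ((a - x0) * m)<..<d} y *
          (fst (g (min b (x0 + y / m), y)) - fst (g (a, y)))) =
     (LINT y|lborel. indicator {max c ((a - x0) * m)<..<d} y * (fst (g (min b (x0 + y / m), y)))) - ?L"
    unfolding right_diff_distrib
    by (rule Bochner_Integration.integral_diff; rule integrable_indicator_times_continuous) (use m in \<open>auto intro!: cont\<close>)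
  moreover have "(LINT x|lborel. indicator {a<..<min b (x0 + d / m)} x *
          (snd (g (x, d)) - snd (g (x, max c ((x - x0) * m))))) =
     ?T - (LINT x|lborel. indicator {a<..<min b (x0 + d / m)} x * snd (g (x, max c ((x - x0) * m))))"
    unfolding right_diff_distrib
    by (rule Bochner_Integration.integral_diff; rule integrable_indicator_times_continuous) (use m in \<open>auto intro!: cont\<close>)
  moreover note cut_cell_divergence[OF lip ab cd m corner div[unfolded E_def]]
  ultimately show ?thesis
    using 1 2 3 by linarith
qed

text \<open>Passage to a field that is controlled only on the closed cell. S is a box intersected
  with a half-plane, hence convex, which gives an extension with the same Lipschitz
  constant.\<close>

lemma cut_cell_flux:
  fixes g :: "plane \<Rightarrow> plane"
  assumes ab: "a < b" and cd: "c < d" and m: "0 < m" and corner: "(a - x0) * m < d"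
  defines "E \<equiv> {(x, y). a < x \<and> x < b \<and> c < y \<and> y < d \<and> (x - x0) * m < y}"
    and "S \<equiv> {(x, y). a \<le> x \<and> x \<le> b \<and> c \<le> y \<and> y \<le> d \<and> (x - x0) * m \<le> y}"
  assumes lip: "C-lipschitz_on S g"
    and div: "AE p in lebesgue_on E. \<exists>D. (g has_derivative D) (at p) \<and> (\<Sum>b\<in>Basis. D b \<bullet> b) = 0"
    and tangential: "\<And>x y. (x, y) \<in> S \<Longrightarrow> y = (x - x0) * m \<Longrightarrow> m * fst (g (x, y)) = snd (g (x, y))"
  shows "(LINT y|lborel. indicator {max c ((b - x0) * m)<..<d} y * fst (g (b, y))) -
      (LINT y|lborel. indicator {max c ((a - x0) * m)<..<d} y * fst (g (a, y))) +
      (LINT x|lborel. indicator {a<..<min b (x0 + d / m)} x * snd (g (x, d))) -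
      (LINT x|lborel. indicator {a<..<min b (x0 + c / m)} x * snd (g (x, c))) = 0"
proof -
  have S_eq: "S = cbox (a, c) (b, d) \<inter> {p. (m, -1) \<bullet> p \<le> x0 * m}"
    unfolding S_def by (auto simp: mem_box Basis_prod_def algebra_simps)
  have S: "convex S" "closed S"
    unfolding S_eq by (auto intro: convex_Int convex_box closed_Int closed_cbox
        convex_halfspace_le closed_halfspace_le)
  have "(a, d) \<in> S" using ab cd corner by (simp add: S_def)
  then have ne: "S \<noteq> {}" by blast
  \<comment> \<open>\<open>g\<close> is arbitrary outside \<open>S\<close>, but the difference quotients leave \<open>S\<close>: extend along the nearest-point projection.\<close>
  define g' where "g' = (\<lambda>p. g (closest_point S p))"
  have g': "g' p = g p" if "p \<in> S" for p
    using that by (simp add: g'_def closest_point_self)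
  have lip': "C-lipschitz_on UNIV g'"
    unfolding g'_def using lipschitz_on_closest_point[OF lip S ne] .
  have opE: "open E"
    unfolding E_def case_prod_beta
    by (intro open_Collect_conj open_Collect_less continuous_intros)
  have ES: "E \<subseteq> S" by (auto simp: E_def S_def)
  have "AE p in lebesgue. p \<in> E \<longrightarrow> (\<exists>D. (g has_derivative D) (at p) \<and> (\<Sum>b\<in>Basis. D b \<bullet> b) = 0)"
    using div opE by (subst (asm) AE_restrict_space_iff) auto
  then have "AE p in lborel. p \<in> E \<longrightarrow> (\<exists>D. (g has_derivative D) (at p) \<and> (\<Sum>b\<in>Basis. D b \<bullet> b) = 0)"
    by (simp add: AE_completion_iff)
  \<comment> \<open>On the open set E the extension coincides with g, so it has the same derivatives
    there.\<close>
  then have div': "AE p in lborel. p \<in> E \<longrightarrow> (\<exists>D. (g' has_derivative D) (at p) \<and> (\<Sum>b\<in>Basis. D b \<bullet> b) = 0)"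
  proof eventually_elim
    case (elim p)
    have "(g' has_derivative D) (at p)" if "(g has_derivative D) (at p)" "p \<in> E" for D
      by (rule has_derivative_transform_within_open[OF that(1) opE that(2)]) (use ES g' in auto)
    with elim show ?case by blast
  qed
  note flux = cut_cell_flux_extended[OF lip' ab cd m corner div'[unfolded E_def]]
  have mono: "(x - x0) * m < y" if "x < x0 + y / m" for x y
    using that m by (simp add: field_simps)
  have "(LINT y|lborel. indicator {max c ((b - x0) * m)<..<d} y * fst (g' (b, y))) =
      (LINT y|lborel. indicator {max c ((b - x0) * m)<..<d} y * fst (g (b, y)))"
    "(LINT y|lborel. indicator {max c ((a - x0) * m)<..<d} y * fst (g' (a, y))) =
     (LINT y|lborel. indicator {max c ((a - x0) * m)<..<d} y * fst (g (a, y)))"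
    "(LINT x|lborel. indicator {a<..<min b (x0 + d / m)} x * snd (g' (x, d))) =
     (LINT x|lborel. indicator {a<..<min b (x0 + d / m)} x * snd (g (x, d)))"
    "(LINT x|lborel. indicator {a<..<min b (x0 + c / m)} x * snd (g' (x, c))) =
     (LINT x|lborel. indicator {a<..<min b (x0 + c / m)} x * snd (g (x, c)))"
    using ab cd mono less_imp_le[OF mono]
    by (auto intro!: Bochner_Integration.integral_cong simp: g' S_def indicator_def)
  moreover have "m * fst (g' (x, (x - x0) * m)) = snd (g' (x, (x - x0) * m))"
    if "a < x" "x < b" "c < (x - x0) * m" "(x - x0) * m < d" for x
  proof -
    have "(x, (x - x0) * m) \<in> S" using that by (simp add: S_def)
    then show ?thesis using tangential g' by simp
  qed
  ultimately show ?thesis using flux by simp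
qed



section \<open>Arc length integrals over segments\<close>

lemma LINT_unit_interval:
  fixes f :: "real \<Rightarrow> real"
  assumes "continuous_on {0..1} f"
  shows "(LINT t|lebesgue_on {0..1}. f t) = (LINT t|lborel. indicator {0<..<1} t * f t)"
proof -
  have m: "(\<lambda>t. indicator {0..1} t * f t) \<in> borel_measurable borel"
    using borel_measurable_continuous_on_indicator[OF _ assms] by simp
  have "(LINT t|lebesgue_on {0..1}. f t) = (LINT t|lebesgue. indicator {0..1} t * f t)"
    by (subst integral_restrict_space) auto
  also have "\<dots> = (LINT t|lborel. indicator {0..1} t * f t)"
    using m by (subst integral_completion) auto
  also have "\<dots> = (LINT t|lborel. indicator {0<..<1} t * f t)"
  proof (rule integral_cong_AE)
    show "(\<lambda>t. indicator {0..1} t * f t) \<in> borel_measurable lborel" using m by simp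
    have "(\<lambda>t. indicator {0<..<1} t * f t) = (\<lambda>t. indicator {0<..<1} t * (indicator {0..1} t * f t))"
      by (auto simp: indicator_def)
    also have "\<dots> \<in> borel_measurable borel"
      using m by (rule borel_measurable_times[rotated]) auto
    finally show "(\<lambda>t. indicator {0<..<1} t * f t) \<in> borel_measurable lborel" by simp
    show "AE t in lborel. indicator {0..1} t * f t = indicator {0<..<1} t * f t"
      using AE_lborel_singleton[of 0] AE_lborel_singleton[of 1]
      by eventually_elim (auto simp: indicator_def)
  qed
  finally show ?thesis .
qed

lemma continuous_on_linepath_compose:
  assumes "continuous_on (closed_segment a b) f"
  shows "continuous_on {0..1} (\<lambda>t. f (linepath a b t))"
  by (rule continuous_on_compose2[OF assms])
    (auto simp: path_image_linepath[symmetric] path_image_def)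

text \<open>\<open>segment_integral\<close> chooses some pair of end points. A segment determines
  its end points up to order, so the chosen pair is the given one or its reversal, and it is the
  same for every integrand.\<close>

lemma segment_integral_witness:
  assumes "e = closed_segment a b"
  obtains c d where "e = closed_segment c d" "{c, d} = {a, b}"
    "\<And>f. segment_integral e f = dist c d * (LINT t|lebesgue_on {0..1}. f (linepath c d t))"
proof -
  define P where "P = (SOME (u, v). e = closed_segment u v)"
  obtain c d where cd: "P = (c, d)" by (cases P)
  have "(case P of (u, v) \<Rightarrow> e = closed_segment u v)"
    unfolding P_def by (rule someI[of _ "(a, b)"]) (use assms in simp)
  then have e: "e = closed_segment c d" using cd by simp
  show ?thesis
  proof
    show "e = closed_segment c d" by fact
    show "{c, d} = {a, b}" using e assms by (metis closed_segment_eq)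
    show "segment_integral e f = dist c d * (LINT t|lebesgue_on {0..1}. f (linepath c d t))" for f
      using cd unfolding segment_integral_def P_def[symmetric] by simp
  qed
qed

lemma segment_integral_closed_segment:
  assumes "continuous_on (closed_segment a b) f"
  shows "segment_integral (closed_segment a b) f =
    dist a b * (LINT t|lborel. indicator {0<..<1} t * f (linepath a b t))"
proof -
  \<comment> \<open>The substitution t -> 1 - t removes the dependence on the orientation chosen in
    \<open>segment_integral\<close>.\<close>
  have flip: "(LINT t|lborel. indicator {0<..<1} t * f (linepath b a t)) =
      (LINT t|lborel. indicator {0<..<1} t * f (linepath a b t))"
  proof -
    have "(LINT t|lborel. indicator {0<..<1} t * f (linepath b a t)) =
      \<bar>-1\<bar> *\<^sub>R (LINT t|lborel. indicator {0<..<1} (1 + -1 * t) * f (linepath b a (1 + -1 * t)))"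
      by (rule lborel_integral_real_affine) simp
    also have "\<dots> = (LINT t|lborel. indicator {0<..<1} t * f (linepath a b t))"
      by (auto intro!: Bochner_Integration.integral_cong simp: indicator_def linepath_def add.commute)
    finally show ?thesis .
  qed
  obtain c d where cd: "closed_segment a b = closed_segment c d" "{c, d} = {a, b}"
    and eq: "segment_integral (closed_segment a b) f = dist c d * (LINT t|lebesgue_on {0..1}. f (linepath c d t))"
    using segment_integral_witness[OF refl, of a b] by metis
  have "(LINT t|lebesgue_on {0..1}. f (linepath c d t)) = (LINT t|lborel. indicator {0<..<1} t * f (linepath c d t))"
    by (intro LINT_unit_interval continuous_on_linepath_compose) (use assms cd in simp)
  with eq flip cd(2) show ?thesis
    by (auto simp: doubleton_eq_iff dist_commute)
qed

lemma vertical_closed_segment: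
  fixes a p q :: real
  assumes "p \<le> q"
  shows "{a} \<times> {p..q} = closed_segment (a, p) (a, q)"
proof -
  have "y \<in> {p..q} \<longleftrightarrow> (\<exists>u. 0 \<le> u \<and> u \<le> 1 \<and> y = (1 - u) * p + u * q)" for y
    using assms by (simp flip: closed_segment_eq_real_ivl1 add: in_segment)
  then show ?thesis
    by (auto simp: in_segment set_eq_iff algebra_simps)
qed

lemma horizontal_closed_segment:
  fixes a p q :: real
  assumes "p \<le> q"
  shows "{p..q} \<times> {a} = closed_segment (p, a) (q, a)"
proof -
  have "y \<in> {p..q} \<longleftrightarrow> (\<exists>u. 0 \<le> u \<and> u \<le> 1 \<and> y = (1 - u) * p + u * q)" for y
    using assms by (simp flip: closed_segment_eq_real_ivl1 add: in_segment)
  then show ?thesis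
    by (auto simp: in_segment set_eq_iff algebra_simps)
qed

lemma segment_integral_vertical:
  assumes "p < q" "continuous_on ({a} \<times> {p..q}) f"
  shows "segment_integral ({a} \<times> {p..q}) f = (LINT y|lborel. indicator {p<..<q} y * f (a, y))"
proof -
  have lp: "linepath (a, p) (a, q) t = (a, p + (q - p) * t)" for t
    by (simp add: linepath_def algebra_simps)
  have e: "{a} \<times> {p..q} = closed_segment (a, p) (a, q)"
    by (rule vertical_closed_segment) (use assms in simp)
  have "(LINT y|lborel. indicator {p<..<q} y * f (a, y)) =
    \<bar>q - p\<bar> *\<^sub>R (LINT t|lborel. indicator {p<..<q} (p + (q - p) * t) * f (a, p + (q - p) * t))"
    by (rule lborel_integral_real_affine) (use assms in simp)
  also have "(\<lambda>t. indicator {p<..<q} (p + (q - p) * t) * f (a, p + (q - p) * t)) =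
    (\<lambda>t. indicator {0<..<1} t * f (linepath (a, p) (a, q) t))"
  proof
    fix t
    have "p + (q - p) * t < q \<longleftrightarrow> (q - p) * t < (q - p) * 1" by argo
    then have "p + (q - p) * t \<in> {p<..<q} \<longleftrightarrow> t \<in> {0<..<1}"
      using assms(1) by (auto simp: zero_less_mult_iff)
    then show "indicator {p<..<q} (p + (q - p) * t) * f (a, p + (q - p) * t) = indicator {0<..<1} t * f (linepath (a, p) (a, q) t)"
      by (simp add: lp indicator_def)
  qed
  finally show ?thesis
    unfolding e using assms by (subst segment_integral_closed_segment) (auto simp: e dist_Pair_Pair dist_real_def)
qed

lemma segment_integral_horizontal:
  assumes "p < q" "continuous_on ({p..q} \<times> {a}) f"
  shows "segment_integral ({p..q} \<times> {a}) f = (LINT y|lborel. indicator {p<..<q} y * f (y, a))"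
proof -
  have lp: "linepath (p, a) (q, a) t = (p + (q - p) * t, a)" for t
    by (simp add: linepath_def algebra_simps)
  have e: "{p..q} \<times> {a} = closed_segment (p, a) (q, a)"
    by (rule horizontal_closed_segment) (use assms in simp)
  have "(LINT y|lborel. indicator {p<..<q} y * f (y, a)) =
    \<bar>q - p\<bar> *\<^sub>R (LINT t|lborel. indicator {p<..<q} (p + (q - p) * t) * f (p + (q - p) * t, a))"
    by (rule lborel_integral_real_affine) (use assms in simp)
  also have "(\<lambda>t. indicator {p<..<q} (p + (q - p) * t) * f (p + (q - p) * t, a)) =
    (\<lambda>t. indicator {0<..<1} t * f (linepath (p, a) (q, a) t))"
  proof
    fix t
    have "p + (q - p) * t < q \<longleftrightarrow> (q - p) * t < (q - p) * 1" by argo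
    then have "p + (q - p) * t \<in> {p<..<q} \<longleftrightarrow> t \<in> {0<..<1}"
      using assms(1) by (auto simp: zero_less_mult_iff)
    then show "indicator {p<..<q} (p + (q - p) * t) * f (p + (q - p) * t, a) = indicator {0<..<1} t * f (linepath (p, a) (q, a) t)"
      by (simp add: lp indicator_def)
  qed
  finally show ?thesis
    unfolding e using assms by (subst segment_integral_closed_segment) (auto simp: e dist_Pair_Pair dist_real_def)
qed



lemma segment_integral_cong:
  assumes "e = closed_segment a b" "\<And>x. x \<in> e \<Longrightarrow> f x = g x"
  shows "segment_integral e f = segment_integral e g"
proof -
  obtain c d where cd: "e = closed_segment c d"
    and eq: "\<And>f. segment_integral e f = dist c d * (LINT t|lebesgue_on {0..1}. f (linepath c d t))"
    using segment_integral_witness[OF assms(1)] by metis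
  have "f (linepath c d t) = g (linepath c d t)" if "t \<in> {0..1}" for t
    using assms(2)[of "linepath c d t"] cd linepath_in_path[OF that, of c d] by simp
  then show ?thesis
    unfolding eq by (intro arg_cong2[where f = "(*)"] Bochner_Integration.integral_cong) auto
qed

lemma segment_integral_cmult:
  "segment_integral e (\<lambda>x. k * f x) = k * segment_integral e f"
  unfolding segment_integral_def by (simp add: case_prod_unfold Let_def)

lemma segment_integral_nonneg:
  assumes "e = closed_segment a b" "\<And>x. x \<in> e \<Longrightarrow> 0 \<le> f x"
  shows "0 \<le> segment_integral e f"
proof -
  obtain c d where cd: "e = closed_segment c d"
    and eq: "\<And>f. segment_integral e f = dist c d * (LINT t|lebesgue_on {0..1}. f (linepath c d t))"
    using segment_integral_witness[OF assms(1)] by metis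
  have "0 \<le> f (linepath c d t)" if "t \<in> {0..1}" for t
    using assms(2)[of "linepath c d t"] cd linepath_in_path[OF that, of c d] by simp
  then show ?thesis
    unfolding eq by (intro mult_nonneg_nonneg Bochner_Integration.integral_nonneg) auto
qed

lemma segment_integral_pos:
  assumes "e = closed_segment a b" "a \<noteq> b" "continuous_on e f"
    and "\<And>x. x \<in> e \<Longrightarrow> 0 \<le> f x" "x \<in> e" "0 < f x"
  shows "0 < segment_integral e f"
proof -
  obtain c d where cd: "e = closed_segment c d" "{c, d} = {a, b}"
    and eq: "\<And>f. segment_integral e f = dist c d * (LINT t|lebesgue_on {0..1}. f (linepath c d t))"
    using segment_integral_witness[OF assms(1)] by metis
  have ne: "0 < dist c d" using cd(2) assms(2) by (auto simp: doubleton_eq_iff)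
  define f' where "f' = (\<lambda>t. f (linepath c d t))"
  have c: "continuous_on {0..1} f'"
    unfolding f'_def using assms(3) cd(1) continuous_on_linepath_compose by simp
  have nn: "0 \<le> f' t" if "t \<in> {0..1}" for t
    using assms(4)[of "linepath c d t"] cd(1) linepath_in_path[OF that, of c d] by (simp add: f'_def)
  have "(LINT t|lebesgue_on {0..1}. f' t) = integral {0..1} f'"
    using c by (intro lebesgue_integral_eq_integral continuous_imp_integrable_real) auto
  moreover have "(f' has_integral integral {0..1} f') {0..1}"
    using c integrable_continuous_real by blast
  \<comment> \<open>A nonnegative continuous function with integral 0 vanishes identically, contrary
    to its positive value at x.\<close>
  moreover have "integral {0..1} f' \<noteq> 0"
  proof
    assume "integral {0..1} f' = 0"
    then have "(f' has_integral 0) (cbox 0 1)"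
      using \<open>(f' has_integral integral {0..1} f') {0..1}\<close> by simp
    then have z: "f' t = 0" if "t \<in> {0..1}" for t
      using has_integral_0_cbox_imp_0[of 0 1 f' t] c nn that by auto
    obtain t where "t \<in> {0..1}" "x = linepath c d t"
      using assms(5) cd(1) by (metis imageE linepath_image_01)
    then show False using z assms(6) by (auto simp: f'_def)
  qed
  moreover have "0 \<le> integral {0..1} f'"
    using nn by (intro Henstock_Kurzweil_Integration.integral_nonneg integrable_continuous_real c) auto
  ultimately show ?thesis
    unfolding eq f'_def[symmetric] using ne by simp
qed

section \<open>Cells and faces of the mesh\<close>

text \<open>The possible sides of a cell. Every cell is an intersection of five open half-planes,
  with \<open>Slope\<close> redundant away from the ramp, so cut and uncut cells need no separate
  treatment.\<close>

datatype side = West | East | North | South | Slope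

lemma all_side: "(\<forall>s. P s) \<longleftrightarrow> P West \<and> P East \<and> P North \<and> P South \<and> P Slope"
  by (metis side.exhaust)

lemma UNIV_side: "(UNIV :: side set) = {West, East, North, South, Slope}"
  using side.exhaust by auto

instance side :: finite
  by standard (simp add: UNIV_side)

text \<open>The orthogonal complement of w is a line, so the determinant of n and m is 0. For unit
  vectors the squares of determinant and inner product add up to 1, hence the inner product is 1 or
  -1.\<close>

lemma unit_orthogonal_plane:
  fixes n m w :: plane
  assumes "norm n = 1" "norm m = 1" "w \<noteq> 0" "n \<bullet> w = 0" "m \<bullet> w = 0"
  shows "m = n \<or> m = - n"
proof -
  obtain a b where n: "n = (a, b)" by (cases n)
  obtain c d where m: "m = (c, d)" by (cases m)
  obtain x y where w: "w = (x, y)" by (cases w)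
  have ab: "a\<^sup>2 + b\<^sup>2 = 1" and cd: "c\<^sup>2 + d\<^sup>2 = 1"
    using assms(1,2) by (auto simp: n m norm_Pair real_sqrt_eq_1_iff)
  have 1: "a * x + b * y = 0" "c * x + d * y = 0"
    using assms(4,5) by (auto simp: n m w)
  have "(a * d - b * c) * x = 0" "(a * d - b * c) * y = 0"
    using 1 by algebra+
  then have det: "a * d = b * c"
    using assms(3) by (auto simp: w zero_prod_def)
  have "(a * c + b * d)\<^sup>2 = 1"
    using det ab cd by algebra
  then consider "a * c + b * d = 1" | "a * c + b * d = -1"
    by (auto simp: power2_eq_1_iff)
  then show ?thesis
  proof cases
    case 1
    have "c = a" "d = b" using 1 det ab cd by algebra+
    then show ?thesis by (simp add: n m)
  next
    case 2
    have "c = - a" "d = - b" using 2 det ab cd by algebra+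
    then show ?thesis by (simp add: n m)
  qed
qed

context dod_data
begin

primrec normal :: "side \<Rightarrow> plane" where
  "normal West = (-1, 0)"
| "normal East = (1, 0)"
| "normal North = (0, 1)"
| "normal South = (0, -1)"
| "normal Slope = ramp_normal"

primrec offset :: "nat \<Rightarrow> nat \<Rightarrow> side \<Rightarrow> real" where
  "offset i j West = - (real i * h)"
| "offset i j East = real (i + 1) * h"
| "offset i j North = real (j + 1) * h"
| "offset i j South = - (real j * h)"
| "offset i j Slope = x0 * sin \<gamma>"

definition cell :: "nat \<Rightarrow> nat \<Rightarrow> plane set" where
  "cell i j = {p. \<forall>s. normal s \<bullet> p < offset i j s}"

definition polygon :: "nat \<Rightarrow> nat \<Rightarrow> plane set" where
  "polygon i j = {p. \<forall>s. normal s \<bullet> p \<le> offset i j s}"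

text \<open>The side \<open>edge i j s\<close> may be empty or a single point; it is a face only if it is \<open>proper\<close>.\<close>

definition edge :: "nat \<Rightarrow> nat \<Rightarrow> side \<Rightarrow> plane set" where
  "edge i j s = polygon i j \<inter> {p. normal s \<bullet> p = offset i j s}"

definition proper :: "nat \<Rightarrow> nat \<Rightarrow> side \<Rightarrow> bool" where
  "proper i j s \<longleftrightarrow> (\<exists>p\<in>edge i j s. \<exists>q\<in>edge i j s. p \<noteq> q)"

text \<open>Nonemptiness replaces positive measure: the cells are open, so only an empty one is a
  null set.\<close>

definition mesh_index :: "nat \<Rightarrow> nat \<Rightarrow> bool" where
  "mesh_index i j \<longleftrightarrow> real (i + 1) * h \<le> L \<and> real (j + 1) * h \<le> L \<and> cell i j \<noteq> {}"

end

context dod_setting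
begin

lemma sin_cos_tan: "0 < sin \<gamma>" "0 < cos \<gamma>" "0 < tan \<gamma>" "tan \<gamma> * cos \<gamma> = sin \<gamma>"
proof -
  show c: "0 < cos \<gamma>" using gamma_pos gamma_less cos_gt_zero by simp
  then show "tan \<gamma> * cos \<gamma> = sin \<gamma>" by (simp add: tan_def)
qed (use gamma_pos gamma_less sin_gt_zero2 tan_gt_zero in auto)

text \<open>The half-plane of \<open>Slope\<close> is the inequality defining the domain, multiplied
  by cos \<gamma> > 0 so that the normal has length 1.\<close>

lemma slope_less: "normal Slope \<bullet> (x, y) < x0 * sin \<gamma> \<longleftrightarrow> (x - x0) * tan \<gamma> < y"
  and slope_le: "normal Slope \<bullet> (x, y) \<le> x0 * sin \<gamma> \<longleftrightarrow> (x - x0) * tan \<gamma> \<le> y"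
  and slope_eq: "normal Slope \<bullet> (x, y) = x0 * sin \<gamma> \<longleftrightarrow> y = (x - x0) * tan \<gamma>"
proof -
  have "normal Slope \<bullet> (x, y) - x0 * sin \<gamma> = (x - x0) * sin \<gamma> - cos \<gamma> * y"
    by (simp add: ramp_normal_def algebra_simps)
  also have "\<dots> = cos \<gamma> * ((x - x0) * tan \<gamma> - y)"
    unfolding sin_cos_tan(4)[symmetric] by (simp add: algebra_simps)
  finally have *: "normal Slope \<bullet> (x, y) - x0 * sin \<gamma> = cos \<gamma> * ((x - x0) * tan \<gamma> - y)" .
  have "cos \<gamma> * ((x - x0) * tan \<gamma> - y) < 0 \<longleftrightarrow> (x - x0) * tan \<gamma> - y < 0"
    "cos \<gamma> * ((x - x0) * tan \<gamma> - y) \<le> 0 \<longleftrightarrow> (x - x0) * tan \<gamma> - y \<le> 0"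
    "cos \<gamma> * ((x - x0) * tan \<gamma> - y) = 0 \<longleftrightarrow> (x - x0) * tan \<gamma> - y = 0"
    using sin_cos_tan(2) by (auto simp: mult_less_0_iff mult_le_0_iff)
  with * show "normal Slope \<bullet> (x, y) < x0 * sin \<gamma> \<longleftrightarrow> (x - x0) * tan \<gamma> < y"
    "normal Slope \<bullet> (x, y) \<le> x0 * sin \<gamma> \<longleftrightarrow> (x - x0) * tan \<gamma> \<le> y"
    "normal Slope \<bullet> (x, y) = x0 * sin \<gamma> \<longleftrightarrow> y = (x - x0) * tan \<gamma>"
    by linarith+
qed

lemma mem_cell: "(x, y) \<in> cell i j \<longleftrightarrow> real i * h < x \<and> x < real (i + 1) * h \<and>
    real j * h < y \<and> y < real (j + 1) * h \<and> (x - x0) * tan \<gamma> < y"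
  unfolding cell_def by (simp add: all_side slope_less del: normal.simps(5)) auto

lemma mem_polygon: "(x, y) \<in> polygon i j \<longleftrightarrow> real i * h \<le> x \<and> x \<le> real (i + 1) * h \<and>
    real j * h \<le> y \<and> y \<le> real (j + 1) * h \<and> (x - x0) * tan \<gamma> \<le> y"
  unfolding polygon_def by (simp add: all_side slope_le del: normal.simps(5)) auto

lemma norm_normal: "norm (normal s) = 1"
  by (cases s) (auto simp: norm_Pair ramp_normal_def)

lemma inj_normal: "normal s = normal s' \<longleftrightarrow> s = s'"
  using sin_cos_tan by (cases s; cases s') (auto simp: ramp_normal_def)

lemma open_cell: "open (cell i j)"
proof -
  have "cell i j = (\<Inter>s. {p. normal s \<bullet> p < offset i j s})"
    by (auto simp: cell_def)
  then show ?thesis by (auto intro: open_halfspace_lt)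
qed

lemma convex_polygon: "convex (polygon i j)" and closed_polygon: "closed (polygon i j)"
proof -
  have "polygon i j = (\<Inter>s. {p. normal s \<bullet> p \<le> offset i j s})"
    by (auto simp: polygon_def)
  then show "convex (polygon i j)" "closed (polygon i j)"
    by (auto intro!: convex_INT convex_halfspace_le closed_halfspace_le)
qed

lemma polygon_subset_box:
  "polygon i j \<subseteq> {real i * h..real (i + 1) * h} \<times> {real j * h..real (j + 1) * h}"
  using mem_polygon by auto

lemma bounded_polygon: "bounded (polygon i j)"
  by (rule bounded_subset[OF _ polygon_subset_box]) (simp add: bounded_Times)

lemma cell_subset_polygon: "cell i j \<subseteq> polygon i j"
  by (auto simp: cell_def polygon_def less_imp_le)

lemma interior_polygon: "interior (polygon i j) = cell i j"
proof
  show "interior (polygon i j) \<subseteq> cell i j"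
  proof
    fix p assume p: "p \<in> interior (polygon i j)"
    have "normal s \<bullet> p < offset i j s" for s
    proof -
      have "polygon i j \<subseteq> {p. normal s \<bullet> p \<le> offset i j s}"
        by (auto simp: polygon_def)
      then have "p \<in> interior {p. normal s \<bullet> p \<le> offset i j s}"
        using p interior_mono by blast
      moreover have "normal s \<noteq> 0" using norm_normal[of s] by auto
      ultimately show ?thesis by (simp add: interior_halfspace_le)
    qed
    then show "p \<in> cell i j" by (simp add: cell_def)
  qed
  show "cell i j \<subseteq> interior (polygon i j)"
    by (rule interior_maximal[OF cell_subset_polygon open_cell])
qed

text \<open>A closed convex set with nonempty interior is the closure of its interior.\<close>

lemma closure_cell:
  assumes "cell i j \<noteq> {}"
  shows "closure (cell i j) = polygon i j"
  using convex_closure_interior[OF convex_polygon[of i j]] assms closed_polygon[of i j]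
  by (simp add: interior_polygon)

lemma cells_eq: "cells = {cell i j | i j. mesh_index i j}"
proof -
  have eq: "({real i * h <..< real (i + 1) * h} \<times> {real j * h <..< real (j + 1) * h}) \<inter> \<Omega> = cell i j"
    if "real (i + 1) * h \<le> L" "real (j + 1) * h \<le> L" for i j
  proof -
    have "0 \<le> real i * h" "0 \<le> real j * h" using h_pos by auto
    then have "p \<in> ({real i * h <..< real (i + 1) * h} \<times> {real j * h <..< real (j + 1) * h}) \<inter> \<Omega> \<longleftrightarrow> p \<in> cell i j" for p
      using that by (cases p) (simp only: mem_cell \<Omega>_def Int_iff mem_Times_iff mem_Collect_eq case_prod_conv
          greaterThanLessThan_iff fst_conv snd_conv, linarith)
    then show ?thesis by blast
  qed
  have pos: "measure lebesgue (cell i j) > 0 \<longleftrightarrow> cell i j \<noteq> {}" for i j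
  proof -
    have "cell i j \<in> lmeasurable"
      by (rule lmeasurable_open[OF bounded_subset[OF bounded_polygon cell_subset_polygon] open_cell])
    then have "measure lebesgue (cell i j) = 0 \<longleftrightarrow> negligible (cell i j)"
      using negligible_iff_measure0 by blast
    moreover have "negligible (cell i j) \<longleftrightarrow> cell i j = {}"
      using open_not_negligible[OF open_cell, of i j] by auto
    ultimately show ?thesis
      using measure_nonneg[of lebesgue "cell i j"] by linarith
  qed
  show ?thesis
  proof (intro set_eqI iffI)
    fix E assume "E \<in> cells"
    then obtain i j where ij: "real (i + 1) * h \<le> L" "real (j + 1) * h \<le> L"
      and E: "E = ({real i * h <..< real (i + 1) * h} \<times> {real j * h <..< real (j + 1) * h}) \<inter> \<Omega>"
      and m: "measure lebesgue E > 0"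
      unfolding cells_def background_mesh_def by blast
    show "E \<in> {cell i j | i j. mesh_index i j}"
      using ij m pos unfolding E eq[OF ij] mesh_index_def by blast
  next
    fix E assume "E \<in> {cell i j | i j. mesh_index i j}"
    then obtain i j where mij: "mesh_index i j" "E = cell i j" by auto
    then have ij: "real (i + 1) * h \<le> L" "real (j + 1) * h \<le> L" "cell i j \<noteq> {}" "E = cell i j"
      unfolding mesh_index_def by simp_all
    define E' where "E' = {real i * h <..< real (i + 1) * h} \<times> {real j * h <..< real (j + 1) * h}"
    have "E' \<in> background_mesh"
      using ij(1,2) unfolding background_mesh_def E'_def by blast
    moreover have "E = E' \<inter> \<Omega>"
      using eq[OF ij(1,2)] ij(4) by (simp add: E'_def)
    moreover have "measure lebesgue (E' \<inter> \<Omega>) > 0"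
      using pos[of i j] ij calculation(2) by simp
    ultimately show "E \<in> cells"
      unfolding cells_def by blast
  qed
qed

lemma cell_subset_Omega: "mesh_index i j \<Longrightarrow> cell i j \<subseteq> \<Omega>"
  using cells_eq unfolding cells_def by blast

lemma polygon_subset_closure: "mesh_index i j \<Longrightarrow> polygon i j \<subseteq> closure \<Omega>"
  using cell_subset_Omega closure_mono closure_cell unfolding mesh_index_def by metis

lemma edge_subset_closure: "mesh_index i j \<Longrightarrow> edge i j s \<subseteq> closure \<Omega>"
  using polygon_subset_closure unfolding edge_def by blast

lemma finite_mesh_index: "finite {(i, j). mesh_index i j}"
proof -
  obtain N where N: "L = real N * h" using h_divides by blast
  have "i < N" if "real (i + 1) * h \<le> L" for i :: nat
  proof -
    have "real (i + 1) \<le> real N" using that N h_pos by (simp del: of_nat_add)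
    then show ?thesis by simp
  qed
  then have "{(i, j). mesh_index i j} \<subseteq> {..<N} \<times> {..<N}"
    by (auto simp: mesh_index_def)
  then show ?thesis by (rule finite_subset) simp
qed

lemma finite_cells: "finite cells"
proof -
  have "cells = (\<lambda>(i, j). cell i j) ` {(i, j). mesh_index i j}"
    by (auto simp: cells_eq)
  then show ?thesis using finite_mesh_index by simp
qed

lemma cell_inj:
  assumes "p \<in> cell i j" "p \<in> cell i' j'"
  shows "i = i' \<and> j = j'"
proof -
  obtain x y where p: "p = (x, y)" by (cases p)
  have "real i * h < real (i' + 1) * h" "real i' * h < real (i + 1) * h"
    "real j * h < real (j' + 1) * h" "real j' * h < real (j + 1) * h"
    using assms unfolding p mem_cell by linarith+
  then have "i < i' + 1" "i' < i + 1" "j < j' + 1" "j' < j + 1"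
    using h_pos by (auto simp del: of_nat_add)
  then show ?thesis by simp
qed

section \<open>Edges of the closed cells, their normals and neighbors\<close>

lemma edge_face_of: "edge i j s face_of polygon i j"
  unfolding edge_def
  by (rule face_of_Int_supporting_hyperplane_le[OF convex_polygon]) (auto simp: polygon_def)

lemma aff_dim_edge_le: "aff_dim (edge i j s) \<le> 1"
proof -
  have "normal s \<noteq> 0" using norm_normal[of s] by auto
  have "aff_dim (edge i j s) \<le> aff_dim {p. normal s \<bullet> p = offset i j s}"
    by (rule aff_dim_subset) (auto simp: edge_def)
  also have "\<dots> = 1"
    using \<open>normal s \<noteq> 0\<close> by simp
  finally show ?thesis .
qed

lemma aff_dim_edge: "aff_dim (edge i j s) = 1 \<longleftrightarrow> proper i j s"
proof
  assume 1: "aff_dim (edge i j s) = 1"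
  then have "edge i j s \<noteq> {}" by auto
  then obtain p where p: "p \<in> edge i j s" by blast
  then have "edge i j s \<noteq> {p}" using 1 by auto
  then show "proper i j s" using p unfolding proper_def by blast
next
  assume "proper i j s"
  then obtain p q where pq: "p \<in> edge i j s" "q \<in> edge i j s" "p \<noteq> q" unfolding proper_def by blast
  then have "edge i j s \<noteq> {}" "\<nexists>a. edge i j s = {a}" by auto
  then have "aff_dim (edge i j s) \<noteq> -1" "aff_dim (edge i j s) \<noteq> 0"
    by (simp add: aff_dim_empty, simp add: aff_dim_eq_0)
  then show "aff_dim (edge i j s) = 1"
    using aff_dim_edge_le[of i j s] aff_dim_geq[of "edge i j s"] by linarith
qed

text \<open>Matches edges in the sense of convex geometry with the five sides. A one-dimensional
  face avoids the interior, so a relative interior point of it lies on some side. A side is itself a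
  face, so it contains the whole edge as soon as it contains that point, and equal dimension forces
  equality.\<close>

lemma edge_of_polygon:
  assumes ne: "cell i j \<noteq> {}"
  shows "e edge_of polygon i j \<longleftrightarrow> (\<exists>s. e = edge i j s \<and> proper i j s)"
proof
  assume "e edge_of polygon i j"
  then have e: "e face_of polygon i j" "aff_dim e = 1" by (auto simp: edge_of_def)
  have "aff_dim (polygon i j) = 2"
    using aff_dim_nonempty_interior[of "polygon i j"] ne by (simp add: interior_polygon)
  then have "e \<noteq> polygon i j" using e by auto
  then have disj: "e \<inter> cell i j = {}"
    using face_of_disjoint_interior[OF e(1)] by (simp add: interior_polygon)
  have conv: "convex e" using e(1) face_of_imp_convex by blast
  have sub: "e \<subseteq> polygon i j" using e(1) face_of_imp_subset by blast
  have "e \<noteq> {}" using e(2) by auto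
  then obtain x where x: "x \<in> rel_interior e"
    using rel_interior_eq_empty[OF conv] by blast
  then have "x \<in> e" using rel_interior_subset by blast
  then have "x \<in> polygon i j" "x \<notin> cell i j" using sub disj by auto
  then obtain s where "normal s \<bullet> x = offset i j s"
    unfolding polygon_def cell_def by (auto simp: not_less intro: order_antisym)
  then have "x \<in> edge i j s" using \<open>x \<in> polygon i j\<close> by (simp add: edge_def)
  then have es: "e \<subseteq> edge i j s"
    using subset_of_face_of[OF edge_face_of sub, of s] x by blast
  then have "e face_of edge i j s"
    using face_of_subset[OF e(1)] edge_def by auto
  then have "e = edge i j s"
    using face_of_aff_dim_lt[of "edge i j s" e] aff_dim_edge_le[of i j s] e(2)
      face_of_imp_convex[OF edge_face_of] by fastforce
  then show "\<exists>s. e = edge i j s \<and> proper i j s"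
    using e(2) aff_dim_edge by auto
next
  assume "\<exists>s. e = edge i j s \<and> proper i j s"
  then show "e edge_of polygon i j"
    using edge_face_of aff_dim_edge by (auto simp: edge_of_def)
qed

lemma face_of_cell_iff:
  "face_of_cell e E \<longleftrightarrow> (\<exists>i j s. mesh_index i j \<and> proper i j s \<and> E = cell i j \<and> e = edge i j s)"
  using edge_of_polygon closure_cell
  unfolding face_of_cell_def cells_eq mesh_index_def by fastforce

lemma edge_segment:
  assumes "proper i j s"
  obtains a b where "edge i j s = closed_segment a b" "a \<noteq> b"
proof -
  have "edge i j s \<noteq> {}" using assms by (auto simp: proper_def)
  moreover have "compact (edge i j s)"
    using bounded_polygon closed_polygon unfolding edge_def
    by (intro compact_Int_closed closed_hyperplane) (simp add: compact_eq_bounded_closed)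
  moreover have "convex (edge i j s)"
    using face_of_imp_convex[OF edge_face_of] .
  moreover have "collinear (edge i j s)"
    using aff_dim_edge_le by (simp add: collinear_aff_dim)
  ultimately obtain a b where ab: "edge i j s = closed_segment a b"
    using compact_convex_collinear_segment by blast
  then have "a \<noteq> b" using assms by (auto simp: proper_def)
  with ab that show ?thesis by blast
qed

lemma normal_cases:
  assumes "p \<in> edge i j s" "q \<in> edge i j s" "p \<noteq> q" "n \<bullet> (p - q) = 0" "norm n = 1"
  shows "n = normal s \<or> n = - normal s"
proof (rule unit_orthogonal_plane[of "normal s" n "p - q"])
  show "normal s \<bullet> (p - q) = 0"
    using assms(1,2) by (simp add: edge_def inner_diff_right)
qed (use assms norm_normal in auto)

text \<open>Only two unit vectors are orthogonal to the edge, and the position of the cell selects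
  one of them. \<open>proper\<close> supplies the direction to be orthogonal to.\<close>

lemma outer_normal_edge:
  assumes ne: "cell i j \<noteq> {}" and pr: "proper i j s"
  shows "outer_normal (cell i j) (edge i j s) = normal s"
  unfolding outer_normal_def
proof (rule the_equality)
  show "norm (normal s) = 1 \<and> (\<forall>x\<in>edge i j s. \<forall>y\<in>edge i j s. normal s \<bullet> (x - y) = 0) \<and>
      (\<forall>x\<in>cell i j. \<forall>y\<in>edge i j s. normal s \<bullet> (x - y) < 0)"
    using norm_normal by (auto simp: edge_def cell_def inner_diff_right)
next
  fix n
  assume n: "norm n = 1 \<and> (\<forall>x\<in>edge i j s. \<forall>y\<in>edge i j s. n \<bullet> (x - y) = 0) \<and>
      (\<forall>x\<in>cell i j. \<forall>y\<in>edge i j s. n \<bullet> (x - y) < 0)"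
  obtain p q where pq: "p \<in> edge i j s" "q \<in> edge i j s" "p \<noteq> q"
    using pr unfolding proper_def by blast
  then have "n = normal s \<or> n = - normal s"
    using n normal_cases by blast
  moreover have "n \<noteq> - normal s"
  proof
    assume m: "n = - normal s"
    obtain z where z: "z \<in> cell i j" using ne by blast
    then have "n \<bullet> (z - p) < 0" using n pq by blast
    moreover have "normal s \<bullet> (z - p) < 0"
      using z pq(1) by (simp add: edge_def cell_def inner_diff_right)
    ultimately show False by (simp add: m)
  qed
  ultimately show "n = normal s" by blast
qed

text \<open>If both points lay on a second side, its normal would be parallel to the first one:
  equal normals are excluded by \<open>inj_normal\<close>, and opposite ones would leave no room for
  the cell. The midpoint is therefore a point from which the cell can be entered.\<close>

lemma midpoint_edge:
  assumes ne: "cell i j \<noteq> {}" and pq: "p \<in> edge i j s" "q \<in> edge i j s" "p \<noteq> q"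
  shows "normal s \<bullet> midpoint p q = offset i j s"
    and "s' \<noteq> s \<Longrightarrow> normal s' \<bullet> midpoint p q < offset i j s'"
proof -
  have mid: "normal s' \<bullet> midpoint p q = (normal s' \<bullet> p + normal s' \<bullet> q) / 2" for s'
    by (simp add: midpoint_def inner_add_right)
  show "normal s \<bullet> midpoint p q = offset i j s"
    using pq(1,2) by (simp add: mid edge_def)
  assume s': "s' \<noteq> s"
  have le: "normal s' \<bullet> p \<le> offset i j s'" "normal s' \<bullet> q \<le> offset i j s'"
    using pq(1,2) by (auto simp: edge_def polygon_def)
  have "\<not> (normal s' \<bullet> p = offset i j s' \<and> normal s' \<bullet> q = offset i j s')"
  proof
    assume eq: "normal s' \<bullet> p = offset i j s' \<and> normal s' \<bullet> q = offset i j s'"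
    then have "normal s' \<bullet> (p - q) = 0" by (simp add: inner_diff_right)
    then have opp: "normal s' = - normal s"
      using normal_cases[OF pq _ norm_normal[of s']] inj_normal s' by auto
    obtain z where "z \<in> cell i j" using ne by blast
    then have "normal s \<bullet> z < normal s \<bullet> p" "normal s' \<bullet> z < normal s' \<bullet> p"
      using eq pq(1) by (auto simp: cell_def edge_def)
    then show False by (simp add: opp)
  qed
  then have "normal s' \<bullet> p < offset i j s' \<or> normal s' \<bullet> q < offset i j s'"
    using le by (auto simp: less_le)
  then show "normal s' \<bullet> midpoint p q < offset i j s'"
    using le unfolding mid by auto
qed

lemma eventually_in_cell:
  assumes "normal s \<bullet> m = offset i j s" "\<And>s'. s' \<noteq> s \<Longrightarrow> normal s' \<bullet> m < offset i j s'"
  shows "\<forall>\<^sub>F t in at_right 0. m - t *\<^sub>R normal s \<in> cell i j"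
proof -
  have "\<forall>\<^sub>F t in at_right 0. normal s' \<bullet> (m - t *\<^sub>R normal s) < offset i j s'" for s'
  proof (cases "s' = s")
    case True
    have "normal s \<bullet> normal s = 1"
      using norm_normal[of s] by (simp add: norm_eq_1)
    then have "normal s' \<bullet> (m - t *\<^sub>R normal s) < offset i j s'" if "t > 0" for t
      using True assms(1) that by (simp add: inner_diff_right)
    then show ?thesis
      by (auto simp: eventually_at_filter)
  next
    case False
    have "((\<lambda>t. normal s' \<bullet> (m - t *\<^sub>R normal s)) \<longlongrightarrow> normal s' \<bullet> (m - 0 *\<^sub>R normal s)) (at_right 0)"
      by (intro tendsto_intros)
    then show ?thesis
      using assms(2)[OF False] by (intro order_tendstoD(2)) auto
  qed
  then have "\<forall>\<^sub>F t in at_right 0. \<forall>s'. normal s' \<bullet> (m - t *\<^sub>R normal s) < offset i j s'"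
    by (intro eventually_all_finite) auto
  then show ?thesis by (simp add: cell_def)
qed

text \<open>Both cells contain the points slightly inside the midpoint of the common side, and open
  cells with different indices are disjoint.\<close>

lemma index_unique:
  assumes ne: "cell i j \<noteq> {}" "cell i' j' \<noteq> {}"
    and eq: "edge i j s = edge i' j' s" and pr: "proper i j s"
  shows "i = i' \<and> j = j'"
proof -
  obtain p q where pq: "p \<in> edge i j s" "q \<in> edge i j s" "p \<noteq> q"
    using pr unfolding proper_def by blast
  then have pq': "p \<in> edge i' j' s" "q \<in> edge i' j' s" using eq by auto
  let ?m = "midpoint p q"
  have "\<forall>\<^sub>F t in at_right 0. ?m - t *\<^sub>R normal s \<in> cell i j"
    using midpoint_edge[OF ne(1) pq] by (intro eventually_in_cell) auto
  moreover have "\<forall>\<^sub>F t in at_right 0. ?m - t *\<^sub>R normal s \<in> cell i' j'"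
    using midpoint_edge[OF ne(2) pq' pq(3)] by (intro eventually_in_cell) auto
  ultimately have "\<forall>\<^sub>F t in at_right (0::real). i = i' \<and> j = j'"
    by eventually_elim (use cell_inj in blast)
  then show ?thesis by simp
qed

text \<open>The normals are parallel, being orthogonal to the same edge. Equal normals would put
  both cells on the same side of e, where \<open>index_unique\<close> identifies them.\<close>

lemma outer_normal_opposite:
  assumes "face_of_cell e E" "face_of_cell e E'" "E \<noteq> E'"
  shows "outer_normal E' e = - outer_normal E e"
proof -
  obtain i j s where 1: "mesh_index i j" "proper i j s" "E = cell i j" "e = edge i j s"
    using assms(1) by (auto simp: face_of_cell_iff)
  obtain i' j' s' where 2: "mesh_index i' j'" "proper i' j' s'" "E' = cell i' j'" "e = edge i' j' s'"
    using assms(2) by (auto simp: face_of_cell_iff)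
  obtain p q where pq: "p \<in> edge i j s" "q \<in> edge i j s" "p \<noteq> q"
    using 1(2) unfolding proper_def by blast
  then have pq': "p \<in> edge i' j' s'" "q \<in> edge i' j' s'" using 1 2 by auto
  then have "normal s' \<bullet> (p - q) = 0"
    by (simp add: inner_diff_right edge_def)
  then have "normal s' = normal s \<or> normal s' = - normal s"
    using normal_cases[OF pq _ norm_normal] by blast
  moreover have "normal s' \<noteq> normal s"
  proof
    assume "normal s' = normal s"
    then have "s' = s" by (simp add: inj_normal)
    then have "edge i j s = edge i' j' s" using 1(4) 2(4) by simp
    then have "i = i' \<and> j = j'"
      using index_unique[OF _ _ _ 1(2)] 1(1) 2(1) unfolding mesh_index_def by blast
    then show False using 1 2 assms(3) by simp
  qed
  ultimately show ?thesis
    using outer_normal_edge[of i j s] outer_normal_edge[of i' j' s'] 1 2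
    unfolding mesh_index_def by metis
qed

lemma norm_outer_normal: "face_of_cell e E \<Longrightarrow> norm (outer_normal E e) = 1"
  using outer_normal_edge norm_normal unfolding face_of_cell_iff mesh_index_def by metis

text \<open>Distinct cells at e have opposite outer normals, and three nonzero vectors cannot be
  pairwise opposite.\<close>

lemma cells_of_face:
  assumes "face_of_cell e E"
  obtains "{E. face_of_cell e E} = {E}"
  | E' where "{E. face_of_cell e E} = {E, E'}" "E' \<noteq> E" "face_of_cell e E'"
proof (cases "\<exists>E'. E' \<noteq> E \<and> face_of_cell e E'")
  case True
  then obtain E' where E': "E' \<noteq> E" "face_of_cell e E'" by blast
  have "E'' = E \<or> E'' = E'" if "face_of_cell e E''" for E''
  proof (rule ccontr)
    assume "\<not> (E'' = E \<or> E'' = E')"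
    then have "outer_normal E'' e = - outer_normal E e" "outer_normal E'' e = - outer_normal E' e"
      "outer_normal E' e = - outer_normal E e"
      using outer_normal_opposite assms E' that by metis+
    then have "2 *\<^sub>R outer_normal E e = 0"
      by (metis eq_neg_iff_add_eq_0 minus_minus scaleR_2)
    then have "outer_normal E e = 0" by simp
    then show False using norm_outer_normal[OF assms] by simp
  qed
  then show ?thesis using that(2) E' assms by blast
next
  case False
  then show ?thesis using that(1) assms by blast
qed

lemma face_segment:
  assumes "face_of_cell e E"
  obtains a b where "e = closed_segment a b" "a \<noteq> b"
  using assms edge_segment unfolding face_of_cell_iff by metis

lemma face_subset_closure: "face_of_cell e E \<Longrightarrow> e \<subseteq> closure \<Omega>"
  using edge_subset_closure unfolding face_of_cell_iff by blast

lemma face_subset_cell_closure: "face_of_cell e E \<Longrightarrow> e \<subseteq> closure E"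
  unfolding face_of_cell_def edge_of_def using face_of_imp_subset by blast

lemma continuous_beta: "continuous_on (closure \<Omega>) \<beta>"
  using beta_lipschitz lipschitz_on_continuous_on by blast

lemma continuous_flux: "face_of_cell e E \<Longrightarrow> continuous_on e (\<lambda>x. \<beta> x \<bullet> n)"
  using continuous_on_subset[OF continuous_beta face_subset_closure]
  by (intro continuous_intros) auto

lemma frontier_Omega:
  assumes "p \<in> closure \<Omega>" "p \<notin> \<Omega>" shows "p \<in> frontier \<Omega>"
  using assms interior_subset unfolding frontier_def by blast

lemma slope_edge_subset_ramp:
  assumes "mesh_index i j" shows "edge i j Slope \<subseteq> ramp"
proof
  fix p assume p: "p \<in> edge i j Slope"
  obtain x y where xy: "p = (x, y)" by (cases p)
  have y: "y = (x - x0) * tan \<gamma>"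
    using p slope_eq[of x y] by (simp add: edge_def xy)
  then have "p \<notin> \<Omega>" by (simp add: \<Omega>_def xy)
  then show "p \<in> ramp"
    using frontier_Omega edge_subset_closure[OF assms] p y by (auto simp: ramp_def xy)
qed

text \<open>An edge of a cell is a face of the mesh only if it is shared or lies on the boundary of
  the domain, so a hole in the mesh has to be excluded. Unless the side is \<open>Slope\<close>, its
  midpoint lies strictly above the ramp; hence the adjacent background square, if it fits into the
  large square, meets the domain and yields the second cell.\<close>

lemma face_in_faces:
  assumes "face_of_cell e E"
  shows "e \<in> faces"
proof -
  obtain i j s where ij: "mesh_index i j" "proper i j s" "E = cell i j" "e = edge i j s"
    using assms by (auto simp: face_of_cell_iff)
  have ne: "cell i j \<noteq> {}" and iL: "real (i + 1) * h \<le> L" and jL: "real (j + 1) * h \<le> L"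
    using ij(1) by (auto simp: mesh_index_def simp del: of_nat_add)
  obtain N where N: "L = real N * h" using h_divides by blast
  \<comment> \<open>Since h divides L, a background square that does not touch the right or top
    boundary has a complete successor.\<close>
  have next_le: "real (k + 2) * h \<le> L" if "real (k + 1) * h \<le> L" "real (k + 1) * h \<noteq> L" for k
  proof -
    have "k + 1 < N" using that h_pos by (auto simp: N simp del: of_nat_add)
    then have "real (k + 2) \<le> real N" by linarith
    then show ?thesis using h_pos by (simp add: N)
  qed
  obtain p q where pq: "p \<in> edge i j s" "q \<in> edge i j s" "p \<noteq> q"
    using ij(2) unfolding proper_def by blast
  obtain x y where m: "midpoint p q = (x, y)" by (cases "midpoint p q")
  note mid = midpoint_edge[OF ne pq, unfolded m]
  have boundary: "e \<in> faces" if "e \<inter> \<Omega> = {}"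
  proof -
    have "e \<subseteq> frontier \<Omega>"
      using that frontier_Omega face_subset_closure[OF assms] by blast
    then show ?thesis using assms unfolding faces_def boundary_faces_def by blast
  qed
  \<comment> \<open>The candidate neighbor (i', j') sees the edge as its side s'; moving inward from
    the midpoint shows that its cell is nonempty.\<close>
  have interior: "e \<in> faces"
    if ij': "real (i' + 1) * h \<le> L" "real (j' + 1) * h \<le> L" "(i', j') \<noteq> (i, j)"
      and eq: "edge i' j' s' = edge i j s" and "normal s' \<bullet> (x, y) = offset i' j' s'"
      and "\<And>s''. s'' \<noteq> s' \<Longrightarrow> normal s'' \<bullet> (x, y) < offset i' j' s''" for i' j' s'
  proof -
    have "\<forall>\<^sub>F t in at_right 0. (x, y) - t *\<^sub>R normal s' \<in> cell i' j'"
      by (rule eventually_in_cell) (use that in auto)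
    then have ne': "cell i' j' \<noteq> {}"
      using eventually_happens trivial_limit_at_right_real by blast
    then have "mesh_index i' j'" using ij' unfolding mesh_index_def by blast
    moreover have "proper i' j' s'" using eq ij(2) unfolding proper_def by simp
    ultimately have "face_of_cell e (cell i' j')"
      using eq ij(4) unfolding face_of_cell_iff by metis
    moreover have "cell i' j' \<noteq> cell i j"
      using ne' ij'(3) cell_inj by blast
    ultimately show ?thesis
      using assms ij(3) unfolding faces_def interior_faces_def by blast
  qed
  show ?thesis
  proof (cases s)
    case West
    have xy: "x = real i * h" "real j * h < y" "y < real (j + 1) * h" "(x - x0) * tan \<gamma> < y"
      using mid(1) mid(2)[of North] mid(2)[of South] mid(2)[of Slope] slope_less[of x y] West by auto
    show ?thesis
    proof (cases i)
      case 0
      then show ?thesis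
        by (intro boundary) (auto simp: ij West edge_def \<Omega>_def)
    next
      case (Suc i')
      have "edge i' j East = edge i j West"
        using h_pos by (auto simp: edge_def mem_polygon Suc algebra_simps)
      moreover have "real (i' + 1) * h \<le> L"
        using iL h_pos by (simp add: Suc algebra_simps)
      moreover have "normal s'' \<bullet> (x, y) < offset i' j s''" if "s'' \<noteq> East" for s''
        using that xy slope_less[of x y] h_pos by (cases s'') (auto simp: Suc algebra_simps simp del: normal.simps(5))
      ultimately show ?thesis
        using xy jL by (intro interior[of i' j East]) (auto simp: Suc West)
    qed
  next
    case East
    have xy: "x = real (i + 1) * h" "real j * h < y" "y < real (j + 1) * h" "(x - x0) * tan \<gamma> < y"
      using mid(1) mid(2)[of North] mid(2)[of South] mid(2)[of Slope] slope_less[of x y] East by auto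
    show ?thesis
    proof (cases "real (i + 1) * h = L")
      case True
      then show ?thesis
        by (intro boundary) (auto simp: ij East edge_def \<Omega>_def)
    next
      case False
      have "edge (Suc i) j West = edge i j East"
        using h_pos by (auto simp: edge_def mem_polygon algebra_simps)
      moreover have "real (Suc i + 1) * h \<le> L"
        using next_le[OF iL False] by simp
      moreover have "normal s'' \<bullet> (x, y) < offset (Suc i) j s''" if "s'' \<noteq> West" for s''
        using that xy slope_less[of x y] h_pos by (cases s'') (auto simp: algebra_simps simp del: normal.simps(5))
      ultimately show ?thesis
        using xy jL by (intro interior[of "Suc i" j West]) (auto simp: East)
    qed
  next
    case South
    have xy: "y = real j * h" "real i * h < x" "x < real (i + 1) * h" "(x - x0) * tan \<gamma> < y"
      using mid(1) mid(2)[of East] mid(2)[of West] mid(2)[of Slope] slope_less[of x y] South by auto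
    show ?thesis
    proof (cases j)
      case 0
      then show ?thesis
        by (intro boundary) (auto simp: ij South edge_def \<Omega>_def)
    next
      case (Suc j')
      have "edge i j' North = edge i j South"
        using h_pos by (auto simp: edge_def mem_polygon Suc algebra_simps)
      moreover have "real (j' + 1) * h \<le> L"
        using jL h_pos by (simp add: Suc algebra_simps)
      moreover have "normal s'' \<bullet> (x, y) < offset i j' s''" if "s'' \<noteq> North" for s''
        using that xy slope_less[of x y] h_pos by (cases s'') (auto simp: Suc algebra_simps simp del: normal.simps(5))
      ultimately show ?thesis
        using xy iL by (intro interior[of i j' North]) (auto simp: Suc South)
    qed
  next
    case North
    have xy: "y = real (j + 1) * h" "real i * h < x" "x < real (i + 1) * h" "(x - x0) * tan \<gamma> < y"
      using mid(1) mid(2)[of East] mid(2)[of West] mid(2)[of Slope] slope_less[of x y] North by auto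
    show ?thesis
    proof (cases "real (j + 1) * h = L")
      case True
      then show ?thesis
        by (intro boundary) (auto simp: ij North edge_def \<Omega>_def)
    next
      case False
      have "edge i (Suc j) South = edge i j North"
        using h_pos by (auto simp: edge_def mem_polygon algebra_simps)
      moreover have "real (Suc j + 1) * h \<le> L"
        using next_le[OF jL False] by simp
      moreover have "normal s'' \<bullet> (x, y) < offset i (Suc j) s''" if "s'' \<noteq> South" for s''
        using that xy slope_less[of x y] h_pos by (cases s'') (auto simp: algebra_simps simp del: normal.simps(5))
      ultimately show ?thesis
        using xy iL by (intro interior[of i "Suc j" South]) (auto simp: North)
    qed
  next
    case Slope
    have "e \<subseteq> frontier \<Omega>"
      using slope_edge_subset_ramp[OF ij(1)] unfolding ij(4) Slope ramp_def by blast
    then show ?thesis using assms unfolding faces_def boundary_faces_def by blast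
  qed
qed

lemma faces_eq: "faces = {e. \<exists>E. face_of_cell e E}"
proof
  show "faces \<subseteq> {e. \<exists>E. face_of_cell e E}"
    by (auto simp: faces_def interior_faces_def boundary_faces_def)
qed (use face_in_faces in auto)

lemma finite_faces: "finite faces"
proof -
  have "faces \<subseteq> (\<lambda>((i, j), s). edge i j s) ` ({(i, j). mesh_index i j} \<times> UNIV)"
    unfolding faces_eq face_of_cell_iff by force
  then show ?thesis
    using finite_mesh_index finite_subset by (metis finite_SigmaI finite_imageI finite)
qed

section \<open>Explicit coordinates of the axis-parallel sides\<close>

lemma edge_West: "edge i j West = {real i * h} \<times> {max (real j * h) ((real i * h - x0) * tan \<gamma>)..real (j + 1) * h}"
  using h_pos by (auto simp: edge_def mem_polygon algebra_simps)

lemma edge_East: "edge i j East =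
    {real (i + 1) * h} \<times> {max (real j * h) ((real (i + 1) * h - x0) * tan \<gamma>)..real (j + 1) * h}"
  using h_pos by (auto simp: edge_def mem_polygon algebra_simps)

lemma tan_le: "(x - x0) * tan \<gamma> \<le> y \<longleftrightarrow> x \<le> x0 + y / tan \<gamma>"
  using sin_cos_tan(3) by (simp add: field_simps)

lemma edge_North: "edge i j North =
    {real i * h..min (real (i + 1) * h) (x0 + real (j + 1) * h / tan \<gamma>)} \<times> {real (j + 1) * h}"
proof -
  have "real j * h \<le> real (j + 1) * h" using h_pos by simp
  moreover have "(x, y) \<in> edge i j North \<longleftrightarrow> (x, y) \<in> polygon i j \<and> y = real (j + 1) * h" for x y
    by (simp add: edge_def)
  ultimately show ?thesis
    by (auto simp: mem_polygon tan_le simp del: of_nat_add)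
qed

lemma edge_South: "edge i j South =
    {real i * h..min (real (i + 1) * h) (x0 + real j * h / tan \<gamma>)} \<times> {real j * h}"
proof -
  have "real j * h \<le> real (j + 1) * h" using h_pos by simp
  moreover have "(x, y) \<in> edge i j South \<longleftrightarrow> (x, y) \<in> polygon i j \<and> y = real j * h" for x y
    by (simp add: edge_def)
  ultimately show ?thesis
    by (auto simp: mem_polygon tan_le simp del: of_nat_add)
qed

lemma proper_vertical:
  assumes "edge i j s = {a} \<times> {p..q}"
  shows "proper i j s \<longleftrightarrow> p < q"
proof
  assume "p < q"
  then have "(a, p) \<in> edge i j s" "(a, q) \<in> edge i j s" "(a, p) \<noteq> (a, q)" using assms by auto
  then show "proper i j s" unfolding proper_def by blast
qed (use assms in \<open>auto simp: proper_def\<close>)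

lemma proper_horizontal:
  assumes "edge i j s = {p..q} \<times> {a}"
  shows "proper i j s \<longleftrightarrow> p < q"
proof
  assume "p < q"
  then have "(p, a) \<in> edge i j s" "(q, a) \<in> edge i j s" "(p, a) \<noteq> (q, a)" using assms by auto
  then show "proper i j s" unfolding proper_def by blast
qed (use assms in \<open>auto simp: proper_def\<close>)

end

section \<open>Fluxes through faces\<close>

text \<open>For a function of constant sign, a positive integral expresses the pointwise condition
  of \<open>outflow_face\<close>; isolated zeros do not matter.\<close>

lemma segment_integral_sign:
  assumes "e = closed_segment a b" "a \<noteq> b" "continuous_on e f"
    and "(\<forall>x\<in>e. 0 \<le> f x) \<or> (\<forall>x\<in>e. f x \<le> 0)"
  shows "0 < segment_integral e f \<longleftrightarrow> (\<forall>x\<in>e. 0 \<le> f x) \<and> (\<exists>x\<in>e. 0 < f x)"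
proof
  assume pos: "0 < segment_integral e f"
  have "\<not> (\<forall>x\<in>e. f x \<le> 0)"
  proof
    assume "\<forall>x\<in>e. f x \<le> 0"
    then have "0 \<le> segment_integral e (\<lambda>x. - 1 * f x)"
      by (intro segment_integral_nonneg[OF assms(1)]) auto
    then show False using pos unfolding segment_integral_cmult by simp
  qed
  then show "(\<forall>x\<in>e. 0 \<le> f x) \<and> (\<exists>x\<in>e. 0 < f x)" using assms(4) by force
next
  assume "(\<forall>x\<in>e. 0 \<le> f x) \<and> (\<exists>x\<in>e. 0 < f x)"
  then show "0 < segment_integral e f"
    using segment_integral_pos[OF assms(1-3)] by blast
qed

text \<open>Every edge of a simplex is the convex hull of two of its vertices, and three vertices
  form three pairs.\<close>

lemma card_edges_triangle:
  assumes "2 simplex T"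
  shows "card {e. e edge_of T} \<le> 3"
proof -
  obtain C where C: "finite C" "\<not> affine_dependent C" "card C = 3" "T = convex hull C"
    using assms by (auto simp: simplex)
  define K where "K = {c. c \<subseteq> C \<and> card c = 2}"
  have fin: "finite K" using C(1) by (simp add: K_def)
  have "card K = 3" using n_subsets[OF C(1), of 2] by (simp add: K_def C(3) numeral_eq_Suc)
  have sub: "{e. e edge_of T} \<subseteq> (\<lambda>c. convex hull c) ` K"
  proof
    fix e assume "e \<in> {e. e edge_of T}"
    then have e: "e face_of T" "aff_dim e = 1" by (auto simp: edge_of_def)
    then obtain c where c: "c \<subseteq> C" "e = convex hull c"
      using face_of_convex_hull_affine_independent[OF C(2)] C(4) by auto
    have "\<not> affine_dependent c" using C(2) c(1) affine_dependent_subset by blast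
    then have "aff_dim e = int (card c) - 1"
      using aff_dim_affine_independent[of c] by (simp add: c(2) aff_dim_convex_hull)
    then have "card c = 2" using e(2) by simp
    then show "e \<in> (\<lambda>c. convex hull c) ` K" using c by (auto simp: K_def)
  qed
  show "card {e. e edge_of T} \<le> 3"
    using card_mono[OF _ sub] card_image_le[OF fin, of "\<lambda>c. convex hull c"] fin \<open>card K = 3\<close> by simp
qed

context dod_setting
begin

definition flux :: "plane set \<Rightarrow> plane set \<Rightarrow> real" where
  "flux E e = segment_integral e (\<lambda>x. \<beta> x \<bullet> outer_normal E e)"

text \<open>Reduces the classification of a face to the sign of one number, which the balance over a
  cell can control.\<close>

lemma outflow_face_iff: "face_of_cell e E \<Longrightarrow> outflow_face E e \<longleftrightarrow> 0 < flux E e"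
proof -
  assume f: "face_of_cell e E"
  obtain a b where ab: "e = closed_segment a b" "a \<noteq> b" using face_segment[OF f] .
  show ?thesis
    unfolding outflow_face_def flux_def
    using segment_integral_sign[OF ab continuous_flux[OF f], of "outer_normal E e"] beta_sign[OF f] f by simp
qed

lemma inflow_face_iff: "face_of_cell e E \<Longrightarrow> inflow_face E e \<longleftrightarrow> flux E e < 0"
proof -
  assume f: "face_of_cell e E"
  obtain a b where ab: "e = closed_segment a b" "a \<noteq> b" using face_segment[OF f] .
  have "0 < segment_integral e (\<lambda>x. \<beta> x \<bullet> - outer_normal E e) \<longleftrightarrow> inflow_face E e"
    unfolding inflow_face_def
    using segment_integral_sign[OF ab continuous_flux[OF f], of "- outer_normal E e"] beta_sign[OF f] f by auto
  then show ?thesis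
    using segment_integral_cmult[of e "-1" "\<lambda>x. \<beta> x \<bullet> outer_normal E e"] by (simp add: flux_def)
qed

lemma faces_of_cell:
  assumes "mesh_index i j"
  shows "{e. face_of_cell e (cell i j)} = edge i j ` {s. proper i j s}"
proof -
  have "i = i' \<and> j = j'" if "cell i j = cell i' j'" "mesh_index i' j'" for i' j'
    using that cell_inj unfolding mesh_index_def by blast
  then show ?thesis
    using assms unfolding face_of_cell_iff by blast
qed

text \<open>Different sides have different outer normals, so they are different faces. This turns
  sums over the faces of a cell into sums over sides.\<close>

lemma inj_on_edge:
  assumes "mesh_index i j"
  shows "inj_on (edge i j) {s. proper i j s}"
proof (rule inj_onI)
  fix s s' assume "s \<in> {s. proper i j s}" "s' \<in> {s. proper i j s}" "edge i j s = edge i j s'"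
  then have "normal s = normal s'"
    using outer_normal_edge[of i j s] outer_normal_edge[of i j s'] assms by (simp add: mesh_index_def)
  then show "s = s'" by (simp add: inj_normal)
qed

lemma beta_slope:
  assumes "mesh_index i j" "x \<in> edge i j Slope" shows "\<beta> x \<bullet> normal Slope = 0"
  using beta_tangential[of x] slope_edge_subset_ramp[OF assms(1)] assms(2) by auto

lemma flux_edge:
  assumes "mesh_index i j" "proper i j s"
  shows "flux (cell i j) (edge i j s) = segment_integral (edge i j s) (\<lambda>x. \<beta> x \<bullet> normal s)"
  using outer_normal_edge[of i j s] assms by (simp add: flux_def mesh_index_def)

lemma flux_slope:
  assumes "mesh_index i j" "proper i j Slope"
  shows "flux (cell i j) (edge i j Slope) = 0"
proof -
  obtain a b where ab: "edge i j Slope = closed_segment a b"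
    using edge_segment[OF assms(2)] .
  have "segment_integral (edge i j Slope) (\<lambda>x. \<beta> x \<bullet> normal Slope) = segment_integral (edge i j Slope) (\<lambda>x. 0 * 0)"
    by (rule segment_integral_cong[OF ab]) (use beta_slope[OF assms(1)] in simp)
  then show ?thesis
    unfolding flux_edge[OF assms] segment_integral_cmult by simp
qed

text \<open>The cell contains a point to the right of its left boundary, and the ramp line rises to
  the right. Consequently the left and top sides of a mesh cell never degenerate.\<close>

lemma corner_less:
  assumes "mesh_index i j"
  shows "(real i * h - x0) * tan \<gamma> < real (j + 1) * h"
proof -
  obtain x y where z: "(x, y) \<in> cell i j"
    using assms unfolding mesh_index_def by auto
  then have "(real i * h - x0) * tan \<gamma> \<le> (x - x0) * tan \<gamma>"
    using sin_cos_tan(3) by (intro mult_right_mono) (auto simp: mem_cell)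
  then show ?thesis using z unfolding mem_cell by linarith
qed

lemma proper_West: "mesh_index i j \<Longrightarrow> proper i j West"
  using corner_less h_pos unfolding proper_vertical[OF edge_West] by simp

lemma proper_North: "mesh_index i j \<Longrightarrow> proper i j North"
  using corner_less[of i j] h_pos tan_le[of "real i * h" "real (j + 1) * h"] sin_cos_tan(3)
  unfolding proper_horizontal[OF edge_North] by (simp add: field_simps)

lemma cell_flux_sum:
  assumes "E \<in> cells"
  shows "(\<Sum>e | face_of_cell e E. flux E e) = 0"
proof -
  obtain i j where ij: "mesh_index i j" and E: "E = cell i j"
    using assms by (auto simp: cells_eq)
  \<comment> \<open>Sides that are not faces get the value 0. For the axis-parallel ones this agrees
    with an integral over an empty interval, so one formula covers every shape of the cut.\<close>
  define \<Phi> where "\<Phi> = (\<lambda>s. if proper i j s then flux E (edge i j s) else 0)"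
  have "(\<Sum>e | face_of_cell e E. flux E e) = (\<Sum>s | proper i j s. flux E (edge i j s))"
    unfolding E faces_of_cell[OF ij] by (simp add: sum.reindex[OF inj_on_edge[OF ij]])
  also have "\<dots> = (\<Sum>s\<in>UNIV. \<Phi> s)"
    unfolding \<Phi>_def by (simp add: sum.If_cases)
  also have "\<dots> = \<Phi> West + \<Phi> East + \<Phi> North + \<Phi> South + \<Phi> Slope"
    by (simp add: UNIV_side)
  also have "\<dots> = 0"
  proof -
    define a b c d where "a = real i * h" and "b = real (i + 1) * h" and "c = real j * h" and "d = real (j + 1) * h"
    note abcd = a_def[symmetric] b_def[symmetric] c_def[symmetric] d_def[symmetric]
    have ab: "a < b" and cd: "c < d" using h_pos by (auto simp: a_def b_def c_def d_def)
    have corner: "(a - x0) * tan \<gamma> < d" using corner_less[OF ij] by (simp add: a_def d_def)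
    have polygon_eq: "polygon i j = {(x, y). a \<le> x \<and> x \<le> b \<and> c \<le> y \<and> y \<le> d \<and> (x - x0) * tan \<gamma> \<le> y}"
      using mem_polygon[of _ _ i j] unfolding abcd by auto
    have cell_eq: "cell i j = {(x, y). a < x \<and> x < b \<and> c < y \<and> y < d \<and> (x - x0) * tan \<gamma> < y}"
      using mem_cell[of _ _ i j] unfolding abcd by auto
    obtain C where "C-lipschitz_on (closure \<Omega>) \<beta>" using beta_lipschitz by blast
    then have lip: "C-lipschitz_on (polygon i j) \<beta>"
      using lipschitz_on_subset polygon_subset_closure[OF ij] by blast
    have div: "AE p in lebesgue_on (cell i j). \<exists>D. (\<beta> has_derivative D) (at p) \<and> (\<Sum>b\<in>Basis. D b \<bullet> b) = 0"
    proof -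
      have "open \<Omega>"
        unfolding \<Omega>_def case_prod_beta by (intro open_Collect_conj open_Collect_less continuous_intros)
      then have "AE p in lebesgue. p \<in> \<Omega> \<longrightarrow> (\<exists>D. (\<beta> has_derivative D) (at p) \<and> (\<Sum>b\<in>Basis. D b \<bullet> b) = 0)"
        using beta_div_free by (subst (asm) AE_restrict_space_iff) auto
      then have "AE p in lebesgue. p \<in> cell i j \<longrightarrow> (\<exists>D. (\<beta> has_derivative D) (at p) \<and> (\<Sum>b\<in>Basis. D b \<bullet> b) = 0)"
        by eventually_elim (use cell_subset_Omega[OF ij] in blast)
      then show ?thesis
        using open_cell[of i j] by (subst AE_restrict_space_iff) auto
    qed
    have tang: "tan \<gamma> * fst (\<beta> (x, y)) = snd (\<beta> (x, y))"
      if "(x, y) \<in> polygon i j" "y = (x - x0) * tan \<gamma>" for x y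
    proof -
      have "(x, y) \<in> edge i j Slope"
        using that slope_eq[of x y] by (simp add: edge_def)
      then have "sin \<gamma> * fst (\<beta> (x, y)) = cos \<gamma> * snd (\<beta> (x, y))"
        using beta_slope[OF ij, of "(x, y)"] by (simp add: ramp_normal_def inner_prod_def mult.commute)
      then show ?thesis using sin_cos_tan(2) by (simp add: tan_def field_simps)
    qed
    note flux = cut_cell_flux[OF ab cd sin_cos_tan(3) corner, folded polygon_eq cell_eq, OF lip div tang]
    have cont: "continuous_on (edge i j s) (\<lambda>x. \<beta> x \<bullet> normal s)" for s
      using continuous_on_subset[OF continuous_beta edge_subset_closure[OF ij]]
      by (intro continuous_intros) auto
    have vertical: "\<Phi> s = (LINT y|lborel. indicator {p<..<q} y * (\<beta> (u, y) \<bullet> normal s))"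
      if e: "edge i j s = {u} \<times> {p..q}" for s u p q
      unfolding \<Phi>_def proper_vertical[OF e]
      using segment_integral_vertical[OF _ cont[of s, unfolded e]] flux_edge[OF ij, of s]
      by (auto simp: E e proper_vertical[OF e])
    have horizontal: "\<Phi> s = (LINT y|lborel. indicator {p<..<q} y * (\<beta> (y, u) \<bullet> normal s))"
      if e: "edge i j s = {p..q} \<times> {u}" for s u p q
      unfolding \<Phi>_def proper_horizontal[OF e]
      using segment_integral_horizontal[OF _ cont[of s, unfolded e]] flux_edge[OF ij, of s]
      by (auto simp: E e proper_horizontal[OF e])
    have "\<Phi> West = - (LINT y|lborel. indicator {max c ((a - x0) * tan \<gamma>)<..<d} y * fst (\<beta> (a, y)))"
      "\<Phi> East = (LINT y|lborel. indicator {max c ((b - x0) * tan \<gamma>)<..<d} y * fst (\<beta> (b, y)))"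
      "\<Phi> North = (LINT x|lborel. indicator {a<..<min b (x0 + d / tan \<gamma>)} x * snd (\<beta> (x, d)))"
      "\<Phi> South = - (LINT x|lborel. indicator {a<..<min b (x0 + c / tan \<gamma>)} x * snd (\<beta> (x, c)))"
      using vertical[OF edge_West] vertical[OF edge_East] horizontal[OF edge_North] horizontal[OF edge_South]
      unfolding abcd by (simp_all add: inner_prod_def)
    moreover have "\<Phi> Slope = 0"
      using flux_slope[OF ij] by (simp add: \<Phi>_def E)
    ultimately show ?thesis using flux by linarith
  qed
  finally show ?thesis .
qed

text \<open>The left and top sides are always proper, and the face on the ramp must be
  \<open>Slope\<close>, the only side parallel to it. A triangle has at most three edges, so there
  is no further one.\<close>

lemma triangular_sides:
  assumes "E \<in> triangular_cut_cells"
  obtains i j where "mesh_index i j" "E = cell i j" "{s. proper i j s} = {West, North, Slope}"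
proof -
  have "E \<in> cells" and simp2: "2 simplex (closure E)" and "\<exists>e. face_of_cell e E \<and> e \<subseteq> ramp"
    using assms by (auto simp: triangular_cut_cells_def)
  then obtain e where e: "face_of_cell e E" "e \<subseteq> ramp" by blast
  obtain i j where ij: "mesh_index i j" and E: "E = cell i j"
    using \<open>E \<in> cells\<close> unfolding cells_eq by blast
  have "e \<in> edge i j ` {s. proper i j s}"
    using e(1) faces_of_cell[OF ij] by (auto simp: E)
  then obtain s where s: "proper i j s" "e = edge i j s" by blast
  obtain p q where pq: "p \<in> edge i j s" "q \<in> edge i j s" "p \<noteq> q"
    using s(1) unfolding proper_def by blast
  have on: "normal Slope \<bullet> p = x0 * sin \<gamma>" if "p \<in> ramp" for p
    using that slope_eq by (auto simp: ramp_def simp del: normal.simps(5))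
  have "normal Slope \<bullet> (p - q) = 0"
    using on[of p] on[of q] pq e(2) s(2) by (simp add: inner_diff_right subset_eq del: normal.simps(5))
  then have "normal Slope = normal s \<or> normal Slope = - normal s"
    using normal_cases[OF pq _ norm_normal] by blast
  then have "s = Slope"
    using sin_cos_tan by (cases s) (auto simp: ramp_normal_def)
  then have sub: "{West, North, Slope} \<subseteq> {s. proper i j s}"
    using s(1) proper_West[OF ij] proper_North[OF ij] by auto
  have "edge i j ` {s. proper i j s} = {e. e edge_of closure E}"
    using edge_of_polygon[of i j] ij closure_cell[of i j] unfolding E mesh_index_def by auto
  then have "card (edge i j ` {s. proper i j s}) \<le> 3"
    using card_edges_triangle[OF simp2] by simp
  then have "card {s. proper i j s} \<le> card {West, North, Slope}"
    by (simp add: card_image[OF inj_on_edge[OF ij]])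
  then have "{s. proper i j s} = {West, North, Slope}"
    using card_seteq[OF _ sub] by simp
  with ij E that show ?thesis by blast
qed

text \<open>Makes the definite descriptions in \<open>e_in\<close> and \<open>e_out\<close>
  meaningful: the hypotenuse carries no flux, so the two legs balance, and it remains to see that
  the flux through a leg is not 0. The normals are recorded to exclude legs shared by two
  triangles.\<close>

lemma triangular_in_out:
  assumes "E \<in> triangular_cut_cells"
  shows "face_of_cell (e_in E) E" "face_of_cell (e_out E) E"
    and "0 < flux E (e_out E)" "flux E (e_in E) = - flux E (e_out E)"
    and "outer_normal E (e_in E) \<in> {(-1, 0), (0, 1)}" "outer_normal E (e_out E) \<in> {(-1, 0), (0, 1)}"
proof -
  obtain i j where ij: "mesh_index i j" and E: "E = cell i j"
    and sides: "{s. proper i j s} = {West, North, Slope}"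
    using triangular_sides[OF assms] .
  have pr: "proper i j West" "proper i j North" "proper i j Slope" and npr: "\<not> proper i j South"
    using sides by auto
  define W N where "W = edge i j West" and "N = edge i j North"
  have faces: "{e. face_of_cell e E} = {W, N, edge i j Slope}"
    unfolding E faces_of_cell[OF ij] sides by (simp add: W_def N_def)
  have ne: "W \<noteq> N" "W \<noteq> edge i j Slope" "N \<noteq> edge i j Slope"
    using inj_on_edge[OF ij] sides unfolding W_def N_def inj_on_def by auto
  have FW: "face_of_cell W E" and FN: "face_of_cell N E" using faces by auto
  have slope0: "flux E (edge i j Slope) = 0" using flux_slope[OF ij pr(3)] by (simp add: E)
  have nW: "outer_normal E W = (-1, 0)" and nN: "outer_normal E N = (0, 1)"
    using outer_normal_edge[of i j] ij pr by (auto simp: E W_def N_def mesh_index_def)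
  have "E \<in> cells" using assms by (simp add: triangular_cut_cells_def)
  from cell_flux_sum[OF this] have sum: "flux E W + flux E N = 0"
    unfolding faces using ne slope0 by simp
  \<comment> \<open>The left end of the hypotenuse: there \<open>\<beta>\<close> is nonzero and parallel to the ramp, hence crosses the left leg.\<close>
  define V where "V = (real i * h, (real i * h - x0) * tan \<gamma>)"
  \<comment> \<open>As the bottom side degenerates, the ramp line meets the left boundary at or
    above the lower corner, so V belongs to the closed cell.\<close>
  have "\<not> real i * h < x0 + real j * h / tan \<gamma>"
    using npr h_pos unfolding proper_horizontal[OF edge_South] by auto
  then have "real j * h \<le> (real i * h - x0) * tan \<gamma>"
    using sin_cos_tan(3) by (simp add: field_simps)
  then have Vp: "V \<in> polygon i j"
    using corner_less[OF ij] h_pos by (simp add: V_def mem_polygon)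
  then have VW: "V \<in> W" by (simp add: W_def edge_def V_def)
  have "V \<in> edge i j Slope"
    using Vp slope_eq[of "real i * h" "(real i * h - x0) * tan \<gamma>"] by (simp add: edge_def V_def)
  then have "V \<in> ramp" using slope_edge_subset_ramp[OF ij] by blast
  then have "\<beta> V \<noteq> 0" "\<beta> V \<bullet> ramp_normal = 0" using beta_nonzero beta_tangential by auto
  then have VW0: "\<beta> V \<bullet> outer_normal E W \<noteq> 0"
    using sin_cos_tan(2) unfolding nW by (cases "\<beta> V") (auto simp: ramp_normal_def zero_prod_def)
  \<comment> \<open>One point with nonzero normal component suffices, because the sign is constant
    along the face.\<close>
  have "flux E W \<noteq> 0"
  proof -
    have "outflow_face E W \<or> inflow_face E W"
      using beta_sign[OF FW] VW VW0 FW unfolding outflow_face_def inflow_face_def by force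
    then show ?thesis using outflow_face_iff[OF FW] inflow_face_iff[OF FW] by auto
  qed
  then consider (WN) "flux E W > 0" "flux E N < 0" | (NW) "flux E W < 0" "flux E N > 0"
    using sum by linarith
  note in_out = this
  have face_iff: "face_of_cell e E \<longleftrightarrow> e = W \<or> e = N \<or> e = edge i j Slope" for e
    using faces by (simp add: set_eq_iff)
  have out_iff: "outflow_face E e \<longleftrightarrow> (e = W \<or> e = N \<or> e = edge i j Slope) \<and> 0 < flux E e" for e
    unfolding face_iff[symmetric] using outflow_face_iff[of e E] by (auto simp: outflow_face_def)
  have in_iff: "inflow_face E e \<longleftrightarrow> (e = W \<or> e = N \<or> e = edge i j Slope) \<and> flux E e < 0" for e
    unfolding face_iff[symmetric] using inflow_face_iff[of e E] by (auto simp: inflow_face_def)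
  from in_out have "e_out E \<in> {W, N} \<and> e_in E \<in> {W, N} \<and> flux E (e_out E) > 0 \<and> flux E (e_in E) < 0"
  proof cases
    case WN
    have "e_out E = W"
      unfolding e_out_def out_iff using WN slope0 by (intro the_equality) auto
    moreover have "e_in E = N"
      unfolding e_in_def in_iff using WN slope0 by (intro the_equality) auto
    ultimately show ?thesis using WN by simp
  next
    case NW
    have "e_out E = N"
      unfolding e_out_def out_iff using NW slope0 by (intro the_equality) auto
    moreover have "e_in E = W"
      unfolding e_in_def in_iff using NW slope0 by (intro the_equality) auto
    ultimately show ?thesis using NW by simp
  qed
  then show "face_of_cell (e_in E) E" "face_of_cell (e_out E) E"
    "0 < flux E (e_out E)" "flux E (e_in E) = - flux E (e_out E)"
    "outer_normal E (e_in E) \<in> {(-1, 0), (0, 1)}" "outer_normal E (e_out E) \<in> {(-1, 0), (0, 1)}"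
    using FW FN nW nN sum by auto
qed

end

section \<open>Upwind terms and jumps\<close>

text \<open>The averages are constant in r: the part of E near x is open and nonempty, so it has
  positive measure, and the average over it is already c.\<close>

lemma cell_trace_eq:
  assumes "open E" "x \<in> closure E" "v \<in> borel_measurable (lebesgue_on E)"
    and "AE y in lebesgue_on E. v y = c"
  shows "cell_trace E v x = c"
proof -
  have avg: "(LINT y|lebesgue_on (E \<inter> ball x r). v y) / measure lebesgue (E \<inter> ball x r) = c" if r: "r > 0" for r
  proof -
    let ?A = "E \<inter> ball x r"
    have op: "open ?A" using assms(1) by auto
    obtain y where "y \<in> E" "dist y x < r"
      using assms(2) r closure_approachable[of x E] by blast
    then have "y \<in> ?A" by (simp add: dist_commute)
    then have ne: "?A \<noteq> {}" by blast
    have lm: "?A \<in> lmeasurable"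
      by (rule lmeasurable_open[OF bounded_subset[OF bounded_ball] op]) auto
    have pos: "measure lebesgue ?A \<noteq> 0"
      using negligible_iff_measure0[OF lm] open_not_negligible[OF op ne] by simp
    have "AE y in lebesgue. y \<in> E \<longrightarrow> v y = c"
      using assms(1,4) by (subst (asm) AE_restrict_space_iff) auto
    then have "AE y in lebesgue. y \<in> ?A \<longrightarrow> v y = c"
      by eventually_elim auto
    then have ae: "AE y in lebesgue_on ?A. v y = c"
      using op by (subst AE_restrict_space_iff) auto
    have "v \<in> borel_measurable (lebesgue_on ?A)"
      using measurable_restrict_mono[OF assms(3)] by blast
    then have "(LINT y|lebesgue_on ?A. v y) = (LINT y|lebesgue_on ?A. c)"
      using ae by (intro integral_cong_AE) auto
    also have "\<dots> = measure lebesgue ?A * c"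
      using op by (simp add: measure_restrict_space)
    finally show ?thesis using pos by simp
  qed
  have "((\<lambda>r. (LINT y|lebesgue_on (E \<inter> ball x r). v y) / measure lebesgue (E \<inter> ball x r)) \<longlongrightarrow> c) (at_right 0)"
    using avg by (intro tendsto_eventually) (auto simp: eventually_at_filter)
  then show ?thesis
    unfolding cell_trace_def by (intro tendsto_Lim) auto
qed

context dod_setting
begin

text \<open>Taken from the trace, since v itself is determined only almost everywhere.\<close>

definition cell_value :: "(plane \<Rightarrow> real) \<Rightarrow> plane set \<Rightarrow> real" where
  "cell_value v E = (SOME c. \<forall>x\<in>closure E. cell_trace E v x = c)"

definition weight :: "plane set \<Rightarrow> real" where
  "weight e = segment_integral e (abs_flux e)"

lemma cell_trace_value:
  assumes v: "v \<in> V0" and E: "E \<in> cells" and x: "x \<in> closure E"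
  shows "cell_trace E v x = cell_value v E"
proof -
  obtain i j where ij: "mesh_index i j" and Eij: "E = cell i j"
    using E unfolding cells_eq by blast
  obtain c where c: "AE x in lebesgue_on E. v x = c"
    using v E unfolding V0_def by blast
  have "v \<in> borel_measurable (lebesgue_on \<Omega>)"
    using v by (simp add: V0_def)
  then have "v \<in> borel_measurable (lebesgue_on E)"
    using measurable_restrict_mono cell_subset_Omega[OF ij] unfolding Eij by blast
  then have "\<forall>x\<in>closure E. cell_trace E v x = c"
    using cell_trace_eq[OF _ _ _ c] open_cell Eij by blast
  then have "\<forall>x\<in>closure E. cell_trace E v x = cell_value v E"
    unfolding cell_value_def by (rule someI)
  then show ?thesis using x by blast
qed

lemma abs_flux_eq:
  assumes "face_of_cell e E"
  shows "abs_flux e x = \<bar>\<beta> x \<bullet> outer_normal E e\<bar>"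
proof -
  define E0 where "E0 = (SOME E. face_of_cell e E)"
  have "face_of_cell e E0" unfolding E0_def using assms by (rule someI)
  then have "outer_normal E0 e = outer_normal E e \<or> outer_normal E0 e = - outer_normal E e"
    using outer_normal_opposite[OF assms] by blast
  then show ?thesis unfolding abs_flux_def E0_def[symmetric] by auto
qed

text \<open>The constant sign on the face allows the modulus to be taken outside the
  integral.\<close>

lemma weight_eq:
  assumes "face_of_cell e E"
  shows "weight e = \<bar>flux E e\<bar>"
proof -
  obtain a b where ab: "e = closed_segment a b" using face_segment[OF assms] by blast
  have "\<exists>k\<in>{1, -1}. \<forall>x\<in>e. abs_flux e x = k * (\<beta> x \<bullet> outer_normal E e)"
    using beta_sign[OF assms] unfolding abs_flux_eq[OF assms] by auto
  then obtain k :: real where k: "k = 1 \<or> k = -1" "\<And>x. x \<in> e \<Longrightarrow> abs_flux e x = k * (\<beta> x \<bullet> outer_normal E e)"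
    by blast
  have "weight e = k * flux E e"
    unfolding weight_def flux_def segment_integral_cmult[symmetric]
    by (rule segment_integral_cong[OF ab k(2)])
  moreover have "0 \<le> weight e"
    unfolding weight_def by (rule segment_integral_nonneg[OF ab]) (simp add: abs_flux_def)
  ultimately show ?thesis using k(1) by auto
qed

lemma flux_opposite:
  assumes "face_of_cell e E" "face_of_cell e E'" "E \<noteq> E'"
  shows "flux E' e = - flux E e"
  using segment_integral_cmult[of e "-1" "\<lambda>x. \<beta> x \<bullet> outer_normal E e"]
  unfolding flux_def outer_normal_opposite[OF assms] by simp

text \<open>A weighted average of a constant. For weight 0 the mean is 0 by division by zero and may
  differ from the cell value, hence the condition on the weight.\<close>

lemma beta_mean_eq:
  assumes v: "v \<in> V0" and f: "face_of_cell e E" and w: "weight e \<noteq> 0"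
  shows "beta_mean v E e = cell_value v E"
proof -
  obtain a b where ab: "e = closed_segment a b" using face_segment[OF f] by blast
  have E: "E \<in> cells" using f by (simp add: face_of_cell_def)
  have "segment_integral e (\<lambda>x. abs_flux e x * cell_trace E v x) =
      segment_integral e (\<lambda>x. cell_value v E * abs_flux e x)"
    by (rule segment_integral_cong[OF ab])
      (use cell_trace_value[OF v E] face_subset_cell_closure[OF f] in auto)
  then show ?thesis
    unfolding beta_mean_def segment_integral_cmult using w by (simp add: weight_def)
qed

lemma jump_boundary:
  assumes "{E. face_of_cell e E} = {E}"
  shows "jump v e = beta_mean v E e *\<^sub>R outer_normal E e"
  unfolding jump_def assms by simp

lemma jump_interior:
  assumes "{E. face_of_cell e E} = {E, E'}" "E' \<noteq> E"
  shows "jump v e = (beta_mean v E e - beta_mean v E' e) *\<^sub>R outer_normal E e"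
proof -
  have "outer_normal E' e = - outer_normal E e"
    using outer_normal_opposite[of e E E'] assms by blast
  then show ?thesis
    unfolding jump_def assms(1) using assms(2) by (simp add: scaleR_diff_left)
qed

lemma neighbor_eq:
  assumes "{E. face_of_cell e E} = {E, E'}" "E' \<noteq> E"
  shows "neighbor E e = E'"
  unfolding neighbor_def using assms by (intro the_equality) auto

text \<open>Two cells at e have opposite fluxes, so at most one of them is upwind.\<close>

lemma upwind_eq:
  assumes "face_of_cell e E" "0 < flux E e"
  shows "upwind v e = beta_mean v E e"
proof -
  have uniq: "E' = E" if "outflow_face E' e" for E'
  proof (rule ccontr)
    assume "E' \<noteq> E"
    moreover have f: "face_of_cell e E'" using that by (simp add: outflow_face_def)
    moreover have "0 < flux E' e" using outflow_face_iff[OF f] that by simp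
    ultimately show False using flux_opposite[OF assms(1) f] assms(2) by simp
  qed
  have out: "outflow_face E e" using outflow_face_iff[OF assms(1)] assms(2) by simp
  then have "(THE E. outflow_face E e) = E" using uniq by (rule the_equality)
  then show ?thesis unfolding upwind_def using out by auto
qed

lemma upwind_inflow_boundary:
  assumes "{E. face_of_cell e E} = {E}" "flux E e < 0"
  shows "upwind v e = 0"
proof -
  have "\<not> outflow_face E' e" for E'
  proof
    assume o: "outflow_face E' e"
    then have f: "face_of_cell e E'" by (simp add: outflow_face_def)
    then have "E' = E" using assms(1) by blast
    then show False using o outflow_face_iff[OF f] assms(2) by simp
  qed
  then show ?thesis by (simp add: upwind_def)
qed

lemma integral_flux_scaleR:
  assumes "w = \<kappa> *\<^sub>R outer_normal E e"
  shows "segment_integral e (\<lambda>x. k * (\<beta> x \<bullet> w)) = k * \<kappa> * flux E e"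
proof -
  have "(\<lambda>x. k * (\<beta> x \<bullet> w)) = (\<lambda>x. (k * \<kappa>) * (\<beta> x \<bullet> outer_normal E e))"
    by (simp add: assms mult.assoc)
  then show ?thesis by (simp only: segment_integral_cmult flux_def)
qed

lemma integral_abs_flux_mult: "segment_integral e (\<lambda>x. abs_flux e x * k) = k * weight e"
  unfolding weight_def segment_integral_cmult[symmetric] by (simp only: mult.commute)

lemma inner_jump:
  assumes "face_of_cell e E" "w = \<kappa> *\<^sub>R outer_normal E e"
  shows "w \<bullet> w = \<kappa>\<^sup>2"
  using norm_outer_normal[OF assms(1)] by (simp add: assms(2) norm_eq_1 power2_eq_square)

text \<open>With p the upwind value, q the value across the face and F the flux from the upwind
  cell, this is p (p - q) = (p - q)^2 / 2 + (p^2 - q^2) / 2, multiplied by F. A boundary face gives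
  p^2 = p^2 / 2 + p^2 / 2 at outflow and 0 = p^2 / 2 - p^2 / 2 at inflow. On faces without flux
  every term is 0.\<close>

lemma face_identity:
  assumes v: "v \<in> V0" and e: "e \<in> faces"
  shows "segment_integral e (\<lambda>x. upwind v e * (\<beta> x \<bullet> jump v e)) =
    1/2 * segment_integral e (\<lambda>x. abs_flux e x * (jump v e \<bullet> jump v e)) +
    1/2 * (\<Sum>E | face_of_cell e E. (cell_value v E)\<^sup>2 * flux E e)"
proof -
  \<comment> \<open>The reference cell is the upwind one whenever there is one; on an interior face
    its flux is then nonnegative.\<close>
  obtain E where f: "face_of_cell e E"
    and pos: "0 < flux E e \<or> (\<forall>E'. face_of_cell e E' \<longrightarrow> flux E' e \<le> 0)"
  proof (cases "\<exists>E. face_of_cell e E \<and> 0 < flux E e")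
    case True
    with that show ?thesis by blast
  next
    case False
    then have "\<forall>E'. face_of_cell e E' \<longrightarrow> flux E' e \<le> 0" by (meson not_less)
    moreover obtain E0 where "face_of_cell e E0" using e unfolding faces_eq by blast
    ultimately show ?thesis using that by blast
  qed
  note w = weight_eq[OF f]
  from f show ?thesis
  proof (cases rule: cells_of_face)
    case 1
    note J = jump_boundary[OF 1, of v]
    show ?thesis
      unfolding integral_flux_scaleR[OF J] integral_abs_flux_mult inner_jump[OF f J] 1
      using w upwind_eq[OF f, of v] upwind_inflow_boundary[OF 1, of v] beta_mean_eq[OF v f]
      by (cases "flux E e" "0 :: real" rule: linorder_cases) (auto simp: power2_eq_square algebra_simps)
  next
    case (2 E')
    note J = jump_interior[OF 2(1,2), of v]
    have opp: "flux E' e = - flux E e" using flux_opposite[OF f 2(3)] 2(2) by blast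
    have nn: "0 \<le> flux E e"
      using pos 2(3) opp by force
    have sum: "(\<Sum>E | face_of_cell e E. (cell_value v E)\<^sup>2 * flux E e) =
        ((cell_value v E)\<^sup>2 - (cell_value v E')\<^sup>2) * flux E e"
      unfolding 2(1) using 2(2) opp by (simp add: algebra_simps)
    show ?thesis
      unfolding integral_flux_scaleR[OF J] integral_abs_flux_mult inner_jump[OF f J] sum
      using w upwind_eq[OF f, of v] beta_mean_eq[OF v f] beta_mean_eq[OF v 2(3)] nn
      by (cases "flux E e = 0") (auto simp: power2_eq_square algebra_simps)
  qed
qed

lemma sum_cell_values:
  "(\<Sum>e\<in>faces. \<Sum>E | face_of_cell e E. (cell_value v E)\<^sup>2 * flux E e) = 0"
proof -
  have "(\<Sum>e\<in>faces. \<Sum>E | face_of_cell e E. (cell_value v E)\<^sup>2 * flux E e) =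
      (\<Sum>e\<in>faces. \<Sum>E | E \<in> cells \<and> face_of_cell e E. (cell_value v E)\<^sup>2 * flux E e)"
    by (intro sum.cong refl) (auto simp: face_of_cell_def)
  also have "\<dots> = (\<Sum>E\<in>cells. \<Sum>e | e \<in> faces \<and> face_of_cell e E. (cell_value v E)\<^sup>2 * flux E e)"
    by (rule sum.swap_restrict[OF finite_faces finite_cells])
  also have "\<dots> = (\<Sum>E\<in>cells. (cell_value v E)\<^sup>2 * (\<Sum>e | face_of_cell e E. flux E e))"
    by (intro sum.cong refl) (auto simp: sum_distrib_left faces_eq intro!: sum.cong)
  also have "\<dots> = 0"
    by (intro sum.neutral) (simp add: cell_flux_sum)
  finally show ?thesis .
qed

section \<open>Stabilized cells and the sum over the mesh\<close>

lemma stabilized_triangular: "E \<in> stabilized \<Longrightarrow> E \<in> triangular_cut_cells"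
  by (simp add: stabilized_def)

text \<open>Only the left and top legs carry flux, and a face seen from both sides has opposite normals.\<close>

lemma stabilized_face_unique:
  assumes "E \<in> stabilized" "E' \<in> stabilized" "e \<in> {e_in E, e_out E}" "e \<in> {e_in E', e_out E'}"
  shows "E = E'"
proof (rule ccontr)
  assume "E \<noteq> E'"
  note 1 = triangular_in_out[OF stabilized_triangular[OF assms(1)]]
  note 2 = triangular_in_out[OF stabilized_triangular[OF assms(2)]]
  have f: "face_of_cell e E" "face_of_cell e E'"
    and n: "outer_normal E e \<in> {(-1, 0), (0, 1)}" "outer_normal E' e \<in> {(-1, 0), (0, 1)}"
    using 1 2 assms(3,4) by auto
  have "outer_normal E' e = - outer_normal E e"
    using outer_normal_opposite[OF f \<open>E \<noteq> E'\<close>] .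
  then show False using n by auto
qed

lemma stabilized_in_neq_out:
  assumes "E \<in> stabilized" shows "e_in E \<noteq> e_out E"
  using triangular_in_out(3,4)[OF stabilized_triangular[OF assms]] by auto

text \<open>By assumption these faces do not lie on the boundary of the domain, so a second cell
  exists and \<open>neighbor\<close> denotes it.\<close>

lemma stabilized_neighbor:
  assumes "E \<in> stabilized" "e \<in> {e_in E, e_out E}"
  obtains "{E. face_of_cell e E} = {E, neighbor E e}" "neighbor E e \<noteq> E" "face_of_cell e (neighbor E e)"
proof -
  have f: "face_of_cell e E"
    using triangular_in_out(1,2)[OF stabilized_triangular[OF assms(1)]] assms(2) by auto
  have "e \<notin> boundary_faces" using stabilized_not_boundary[OF assms(1)] assms(2) by auto
  then have "e \<in> interior_faces" using face_in_faces[OF f] by (simp add: faces_def)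
  then obtain E1 E2 where "E1 \<noteq> E2" "face_of_cell e E1" "face_of_cell e E2"
    by (auto simp: interior_faces_def)
  then have "{E. face_of_cell e E} \<noteq> {E}" by blast
  then obtain E' where E': "{E. face_of_cell e E} = {E, E'}" "E' \<noteq> E" "face_of_cell e E'"
    using cells_of_face[OF f] by metis
  with neighbor_eq[OF E'(1,2)] that show ?thesis by blast
qed

text \<open>Stated as a correction: the stabilized term minus the plain upwind term on the left,
  half the resulting change of the squared seminorm on the right. It can thus be added to the sum of
  \<open>face_identity\<close> over all faces. The stabilized term lives on \<open>e_out\<close> but
  involves the value across \<open>e_in\<close>; equality of the two fluxes lets the jump at
  \<open>e_in\<close> enter the square.\<close>

lemma stabilized_identity:
  assumes v: "v \<in> V0" and E: "E \<in> stabilized"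
  defines "std \<equiv> \<lambda>e. segment_integral e (\<lambda>x. upwind v e * (\<beta> x \<bullet> jump v e))"
    and "J \<equiv> \<lambda>e. segment_integral e (\<lambda>x. abs_flux e x * (jump v e \<bullet> jump v e))"
  shows "segment_integral (e_out E) (\<lambda>x. (\<alpha> * upwind v (e_out E) + (1 - \<alpha>) * mean_in v E) *
        (\<beta> x \<bullet> jump v (e_out E))) - std (e_out E) =
    1/2 * (\<alpha> * (\<Sum>e\<in>{e_in E, e_out E}. J e) + (1 - \<alpha>) * segment_integral (e_out E)
          (\<lambda>x. abs_flux (e_out E) x * (mean_out v E - mean_in v E)\<^sup>2) - (J (e_in E) + J (e_out E)))"
proof -
  note io = triangular_in_out[OF stabilized_triangular[OF E]]
  define F where "F = flux E (e_out E)"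
  have F: "flux E (e_out E) = F" "flux E (e_in E) = - F" "0 < F" using io by (auto simp: F_def)
  have w: "weight (e_in E) = F" "weight (e_out E) = F"
    using weight_eq[OF io(1)] weight_eq[OF io(2)] F by auto
  obtain N1: "{E'. face_of_cell (e_in E) E'} = {E, neighbor E (e_in E)}" "neighbor E (e_in E) \<noteq> E"
    "face_of_cell (e_in E) (neighbor E (e_in E))"
    using stabilized_neighbor[OF E, of "e_in E"] by auto
  obtain N2: "{E'. face_of_cell (e_out E) E'} = {E, neighbor E (e_out E)}" "neighbor E (e_out E) \<noteq> E"
    "face_of_cell (e_out E) (neighbor E (e_out E))"
    using stabilized_neighbor[OF E, of "e_out E"] by auto
  \<comment> \<open>Values in the cell and in its inflow and outflow neighbors. As r - q = (p - q) -
    (p - r), the quadratic identity applies to p - q and p - r.\<close>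
  define p q r where "p = cell_value v E" and "q = cell_value v (neighbor E (e_in E))"
    and "r = cell_value v (neighbor E (e_out E))"
  have w0: "weight (e_in E) \<noteq> 0" "weight (e_out E) \<noteq> 0" using w F by auto
  have means: "beta_mean v E (e_in E) = p" "beta_mean v E (e_out E) = p" "mean_in v E = q" "mean_out v E = r"
    "beta_mean v (neighbor E (e_in E)) (e_in E) = q" "beta_mean v (neighbor E (e_out E)) (e_out E) = r"
    using beta_mean_eq[OF v _ w0(1)] beta_mean_eq[OF v _ w0(2)] io(1,2) N1(3) N2(3)
    by (auto simp: mean_in_def mean_out_def p_def q_def r_def)
  have Jin: "jump v (e_in E) = (p - q) *\<^sub>R outer_normal E (e_in E)"
    and Jout: "jump v (e_out E) = (p - r) *\<^sub>R outer_normal E (e_out E)"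
    using jump_interior[OF N1(1,2), of v] jump_interior[OF N2(1,2), of v] means by auto
  have up: "upwind v (e_out E) = p"
    using upwind_eq[OF io(2,3)] means by simp
  have JJ: "J (e_in E) = (p - q)\<^sup>2 * F" "J (e_out E) = (p - r)\<^sup>2 * F"
    unfolding J_def integral_abs_flux_mult inner_jump[OF io(1) Jin] inner_jump[OF io(2) Jout] w by auto
  have sumJ: "(\<Sum>e\<in>{e_in E, e_out E}. J e) = J (e_in E) + J (e_out E)"
    using stabilized_in_neq_out[OF E] by simp
  show ?thesis
    unfolding sumJ JJ std_def integral_flux_scaleR[OF Jout] up means F integral_abs_flux_mult w
    by (simp add: power2_eq_square algebra_simps)
qed

text \<open>Both weights in the seminorm are nonnegative, which leads to a nonnegative
  radicand.\<close>

lemma capacity_bounds: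
  assumes "E \<in> stabilized"
  shows "0 \<le> capacity E" "capacity E \<le> 1"
proof -
  have "0 \<le> weight (e_in E)"
    using weight_eq[OF triangular_in_out(1)[OF stabilized_triangular[OF assms]]] by simp
  then show "0 \<le> capacity E"
    unfolding capacity_def weight_def[symmetric] using tau_pos h_pos by simp
  show "capacity E \<le> 1" by (simp add: capacity_def)
qed

lemma integral_abs_flux_nonneg:
  assumes "face_of_cell e E" "0 \<le> k"
  shows "0 \<le> segment_integral e (\<lambda>x. abs_flux e x * k)"
  unfolding integral_abs_flux_mult weight_eq[OF assms(1)] using assms(2) by simp

theorem a_DoD_eq:
  assumes v: "v \<in> V0"
  shows "a_DoD v v = 1/2 * (beta_seminorm v)\<^sup>2"
proof -
  define std where "std = (\<lambda>e. segment_integral e (\<lambda>x. upwind v e * (\<beta> x \<bullet> jump v e)))"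
  define J where "J = (\<lambda>e. segment_integral e (\<lambda>x. abs_flux e x * (jump v e \<bullet> jump v e)))"
  define stab where "stab = (\<lambda>E. segment_integral (e_out E)
        (\<lambda>x. (capacity E * upwind v (e_out E) + (1 - capacity E) * mean_in v E) * (\<beta> x \<bullet> jump v (e_out E))))"
  define semi where "semi = (\<lambda>E. capacity E * (\<Sum>e\<in>{e_in E, e_out E}. J e) +
      (1 - capacity E) * segment_integral (e_out E)
          (\<lambda>x. abs_flux (e_out E) x * (mean_out v E - mean_in v E)\<^sup>2))"
  \<comment> \<open>The radicand of \<open>beta_seminorm\<close>.\<close>
  define S where "S = (\<Sum>e\<in>faces_no_in_out. J e) + (\<Sum>E\<in>stabilized. semi E)"
  note tri = triangular_in_out[OF stabilized_triangular]
  have fin: "finite stabilized"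
    by (rule finite_subset[OF _ finite_cells]) (auto simp: stabilized_def triangular_cut_cells_def)
  have in_faces: "e_in E \<in> faces" "e_out E \<in> faces" if "E \<in> stabilized" for E
    using tri(1,2)[OF that] face_in_faces by auto
  \<comment> \<open>Inflow and outflow faces of all stabilized cells are pairwise different, so sums
    over the images of \<open>e_in\<close> and \<open>e_out\<close> become sums over cells and
    nothing is removed twice.\<close>
  have inj_in: "inj_on e_in stabilized" and inj_out: "inj_on e_out stabilized"
    using stabilized_face_unique by (auto intro!: inj_onI)
  have disj: "e_in ` stabilized \<inter> e_out ` stabilized = {}"
    using stabilized_face_unique stabilized_in_neq_out by fastforce
  have "a_DoD v v = (\<Sum>e\<in>faces_no_out. std e) + (\<Sum>E\<in>stabilized. stab E)"
    unfolding a_DoD_def std_def stab_def ..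
  \<comment> \<open>The plain upwind terms on the outflow faces are added and subtracted, so that
    \<open>face_identity\<close> can be summed over the whole mesh.\<close>
  also have "(\<Sum>e\<in>faces_no_out. std e) = (\<Sum>e\<in>faces. std e) - (\<Sum>E\<in>stabilized. std (e_out E))"
    unfolding faces_no_out_def using in_faces finite_faces
    by (subst sum_diff) (auto simp: sum.reindex[OF inj_out])
  also have "(\<Sum>e\<in>faces. std e) = 1/2 * (\<Sum>e\<in>faces. J e)"
  proof -
    have "(\<Sum>e\<in>faces. std e) = (\<Sum>e\<in>faces. 1/2 * J e + 1/2 * (\<Sum>E | face_of_cell e E. (cell_value v E)\<^sup>2 * flux E e))"
      unfolding std_def J_def by (intro sum.cong refl face_identity[OF v])
    also have "\<dots> = 1/2 * (\<Sum>e\<in>faces. J e)"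
      using sum_cell_values[of v] by (simp only: sum.distrib sum_distrib_left[symmetric] mult_zero_right add_0_right)
    finally show ?thesis .
  qed
  also have "(\<Sum>e\<in>faces. J e) = (\<Sum>e\<in>faces_no_in_out. J e) + (\<Sum>E\<in>stabilized. J (e_in E) + J (e_out E))"
  proof -
    have "(\<Sum>e\<in>faces_no_in_out. J e) = (\<Sum>e\<in>faces. J e) - (\<Sum>e\<in>e_in ` stabilized \<union> e_out ` stabilized. J e)"
      unfolding faces_no_in_out_def using in_faces finite_faces by (intro sum_diff) auto
    moreover have "(\<Sum>e\<in>e_in ` stabilized \<union> e_out ` stabilized. J e) = (\<Sum>E\<in>stabilized. J (e_in E) + J (e_out E))"
      using fin disj by (simp add: sum.union_disjoint sum.reindex[OF inj_in] sum.reindex[OF inj_out] sum.distrib)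
    ultimately show ?thesis by simp
  qed
  finally have "a_DoD v v = 1/2 * ((\<Sum>e\<in>faces_no_in_out. J e) + (\<Sum>E\<in>stabilized. J (e_in E) + J (e_out E))) +
      (\<Sum>E\<in>stabilized. stab E - std (e_out E))"
    by (simp add: sum_subtractf)
  also have "(\<Sum>E\<in>stabilized. stab E - std (e_out E)) =
      (\<Sum>E\<in>stabilized. 1/2 * (semi E - (J (e_in E) + J (e_out E))))"
    unfolding stab_def std_def semi_def J_def by (intro sum.cong refl stabilized_identity[OF v])
  also have "\<dots> = 1/2 * ((\<Sum>E\<in>stabilized. semi E) - (\<Sum>E\<in>stabilized. J (e_in E) + J (e_out E)))"
    by (simp only: sum_distrib_left[symmetric] sum_subtractf)
  finally have a: "a_DoD v v = 1/2 * S"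
    by (simp add: S_def algebra_simps)
  have J0: "0 \<le> J e" if e: "e \<in> faces" for e
  proof -
    obtain E where "face_of_cell e E" using e unfolding faces_eq by blast
    then show ?thesis unfolding J_def by (rule integral_abs_flux_nonneg) simp
  qed
  have "0 \<le> semi E" if E: "E \<in> stabilized" for E
    using capacity_bounds[OF E] J0 in_faces[OF E] integral_abs_flux_nonneg[OF tri(2)[OF E]]
    unfolding semi_def by (intro add_nonneg_nonneg mult_nonneg_nonneg sum_nonneg) auto
  \<comment> \<open>The square of \<open>sqrt S\<close> is the modulus of S, so its sign
    matters.\<close>
  then have "0 \<le> S"
    unfolding S_def using J0 by (intro add_nonneg_nonneg sum_nonneg) (auto simp: faces_no_in_out_def)
  moreover have "beta_seminorm v = sqrt S"
    unfolding beta_seminorm_def S_def semi_def J_def ..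
  ultimately show ?thesis using a by simp
qed

end

theorem lemma4p4:
  fixes L x0 \<gamma> h \<tau> :: real and \<beta> :: "plane \<Rightarrow> plane" and v\<^sub>h :: "plane \<Rightarrow> real"
  assumes "dod_setting L x0 \<gamma> h \<beta> \<tau>"
    and "v\<^sub>h \<in> dod_data.V0 L x0 \<gamma> h"
  shows "dod_data.a_DoD L x0 \<gamma> h \<beta> \<tau> v\<^sub>h v\<^sub>h = 1/2 * (dod_data.beta_seminorm L x0 \<gamma> h \<beta> \<tau> v\<^sub>h)\<^sup>2"
  using dod_setting.a_DoD_eq[OF assms] .

end
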